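(* Let $\mu\in\mathcal{M}$. The kernel of $\Gamma_\mu$ is either trivial or infinite dimensional. It is infinite dimensional if and only if $\mu$ is a purely atomic measure supported on a sequence of points $\{a_k\}_{k\in\mathbb{Z}_+}\subset\mathbb{R}_+$ satisfying the Blaschke condition $$\sum_{k\in\mathbb{Z}_+}\frac{a_k}{a_k^2+1}<\infty.$$
   Context: $\mathbb{R}_+=(0,\infty)$, $\mathbb{Z}_+=\{0,1,2,\dots\}$. $\mathcal{M}$ is the class of positive Borel measures $\mu$ on $\mathbb{R}$ with $\operatorname{supp}\mu\subset[0,\infty)$, $\mu(\{0\})=0$ and $\int_0^\infty e^{-tx}\,d\mu(x)<\infty$ for all $t>0$. For $f\in L^2(\mathbb{R}_+)$, $\mathcal{L}f(x)=\int_0^\infty e^{-tx}f(t)\,dt$, $x>0$. The quadratic form $Q_\mu[f]=\int_0^\infty|\mathcal{L}f(x)|^2\,d\mu(x)$ with domain $\{f\in L^2(\mathbb{R}_+): Q_\mu[f]<\infty\}$ is densely defined, non-negative and closed, and the Hankel operator $\Gamma_\mu$ is by definition the (positive semi-definite) self-adjoint operator on $L^2(\mathbb{R}_+)$ corresponding to the form $Q_\mu$. "Supported on a sequence $\{a_k\}$" means that the complement of $\{a_k\}$ has $\mu$-measure zero (not every $a_k$ is required to carry mass). *)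

theory Defs
  imports "HOL-Analysis.Analysis"
begin

section \<open>The Hilbert space of square-integrable functions on the positive half-line\<close>

text \<open>
  Representatives are Borel functions; this loses nothing, since every Lebesgue measurable
  function agrees almost everywhere with a Borel one.
\<close>

abbreviation halfline :: "real measure" where
  "halfline \<equiv> restrict_space lborel {0<..}"

definition square_integrable :: "(real \<Rightarrow> complex) \<Rightarrow> bool" where
  "square_integrable f \<longleftrightarrow>
     f \<in> borel_measurable halfline \<and> integrable halfline (\<lambda>t. (norm (f t))\<^sup>2)"

definition l2_rel :: "(real \<Rightarrow> complex) \<Rightarrow> (real \<Rightarrow> complex) \<Rightarrow> bool" where
  "l2_rel f g \<longleftrightarrow>
     square_integrable f \<and> square_integrable g \<and> (AE t in halfline. f t = g t)"

lemma square_integrable_zero: "square_integrable (\<lambda>t. 0)"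
  by (simp add: square_integrable_def)

lemma square_integrable_scale:
  assumes "square_integrable f"
  shows "square_integrable (\<lambda>t. c * f t)"
  using assms by (auto simp: square_integrable_def norm_mult power_mult_distrib)

lemma square_integrable_add:
  assumes "square_integrable f" "square_integrable g"
  shows "square_integrable (\<lambda>t. f t + g t)"
proof -
  have [measurable]: "f \<in> borel_measurable halfline" "g \<in> borel_measurable halfline"
    using assms by (auto simp: square_integrable_def)
  have "integrable halfline (\<lambda>t. 2 * (norm (f t))\<^sup>2 + 2 * (norm (g t))\<^sup>2)"
    using assms by (auto simp: square_integrable_def)
  moreover have "norm ((norm (f t + g t))\<^sup>2) \<le> norm (2 * (norm (f t))\<^sup>2 + 2 * (norm (g t))\<^sup>2)" for t
  proof -
    have "(norm (f t + g t))\<^sup>2 \<le> (norm (f t) + norm (g t))\<^sup>2"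
      by (intro power_mono norm_triangle_ineq) auto
    also have "\<dots> \<le> 2 * (norm (f t))\<^sup>2 + 2 * (norm (g t))\<^sup>2"
      using sum_squares_bound[of "norm (f t)" "norm (g t)"] by (simp add: power2_sum)
    finally show ?thesis by simp
  qed
  ultimately have "integrable halfline (\<lambda>t. (norm (f t + g t))\<^sup>2)"
    by (elim Bochner_Integration.integrable_bound) (auto simp del: real_norm_def)
  then show ?thesis by (simp add: square_integrable_def)
qed

lemma square_integrable_uminus:
  "square_integrable f \<Longrightarrow> square_integrable (\<lambda>t. - f t)"
  using square_integrable_scale[of f "-1"] by simp

lemma square_integrable_diff:
  assumes "square_integrable f" "square_integrable g"
  shows "square_integrable (\<lambda>t. f t - g t)"
  using square_integrable_add[OF assms(1) square_integrable_uminus[OF assms(2)]] by simp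

quotient_type l2 = "real \<Rightarrow> complex" / partial: l2_rel
proof (rule part_equivpI)
  show "\<exists>f. l2_rel f f"
    using square_integrable_zero by (auto simp: l2_rel_def)
  show "symp l2_rel"
    by (auto simp: symp_def l2_rel_def elim: eventually_mono)
  show "transp l2_rel"
    by (auto simp: transp_def l2_rel_def elim: eventually_elim2)
qed

instantiation l2 :: ab_group_add
begin

lift_definition zero_l2 :: l2 is "\<lambda>t. 0"
  by (simp add: l2_rel_def square_integrable_zero)

lift_definition plus_l2 :: "l2 \<Rightarrow> l2 \<Rightarrow> l2" is "\<lambda>f g t. f t + g t"
  by (auto simp: l2_rel_def square_integrable_add elim: eventually_elim2)

lift_definition minus_l2 :: "l2 \<Rightarrow> l2 \<Rightarrow> l2" is "\<lambda>f g t. f t - g t"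
  by (auto simp: l2_rel_def square_integrable_diff elim: eventually_elim2)

lift_definition uminus_l2 :: "l2 \<Rightarrow> l2" is "\<lambda>f t. - f t"
  by (auto simp: l2_rel_def square_integrable_uminus elim: eventually_mono)

instance
  by standard
    (transfer, auto simp: l2_rel_def square_integrable_add square_integrable_diff
       square_integrable_uminus square_integrable_zero algebra_simps)+

end

lift_definition l2_scale :: "complex \<Rightarrow> l2 \<Rightarrow> l2" is "\<lambda>c f t. c * f t"
  by (auto simp: l2_rel_def square_integrable_scale elim: eventually_mono)

interpretation l2: vector_space l2_scale
  by standard
    (transfer, auto simp: l2_rel_def square_integrable_add square_integrable_scale algebra_simps)+

lift_definition l2_inner :: "l2 \<Rightarrow> l2 \<Rightarrow> complex" is
  "\<lambda>f g. LINT t|halfline. f t * cnj (g t)"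
proof -
  fix f f' g g' :: "real \<Rightarrow> complex"
  assume ff': "l2_rel f f'" and gg': "l2_rel g g'"
  then have [measurable]: "f \<in> borel_measurable halfline" "f' \<in> borel_measurable halfline"
      "g \<in> borel_measurable halfline" "g' \<in> borel_measurable halfline"
    by (auto simp: l2_rel_def square_integrable_def)
  have [measurable]: "cnj \<in> borel_measurable borel"
    by (intro borel_measurable_continuous_onI continuous_intros)
  have "AE t in halfline. f t = f' t" "AE t in halfline. g t = g' t"
    using ff' gg' by (auto simp: l2_rel_def)
  then have "AE t in halfline. f t * cnj (g t) = f' t * cnj (g' t)"
    by eventually_elim simp
  then show "(LINT t|halfline. f t * cnj (g t)) = (LINT t|halfline. f' t * cnj (g' t))"
    by (intro integral_cong_AE) measurable
qed

definition infinite_dimensional :: "l2 set \<Rightarrow> bool" where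
  "infinite_dimensional V \<longleftrightarrow> \<not> (\<exists>B. finite B \<and> V \<subseteq> l2.span B)"


section \<open>The operator associated with a quadratic form\<close>

text \<open>
  For a sesquilinear form \<open>q\<close> with domain \<open>D\<close>, the associated operator has as domain those
  \<open>f \<in> D\<close> for which there is \<open>g\<close> in the Hilbert space with \<open>q f h = \<langle>g, h\<rangle>\<close> for all \<open>h \<in> D\<close>,
  and maps \<open>f\<close> to \<open>g\<close>. It is given by its graph. For a densely defined, closed, non-negative
  form, the first representation theorem says that this is a non-negative self-adjoint operator.
\<close>

definition form_operator :: "l2 set \<Rightarrow> (l2 \<Rightarrow> l2 \<Rightarrow> complex) \<Rightarrow> (l2 \<times> l2) set" where
  "form_operator D q = {(f, g). f \<in> D \<and> (\<forall>h\<in>D. q f h = l2_inner g h)}"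

definition operator_kernel :: "(l2 \<times> l2) set \<Rightarrow> l2 set" where
  "operator_kernel T = {f. (f, 0) \<in> T}"


section \<open>Measures\<close>

definition measure_support :: "real measure \<Rightarrow> real set" where
  "measure_support \<mu> = {x. \<forall>U. open U \<longrightarrow> x \<in> U \<longrightarrow> emeasure \<mu> U > 0}"

definition laplace_measures :: "real measure set" where
  "laplace_measures = {\<mu>. sets \<mu> = sets borel \<and> measure_support \<mu> \<subseteq> {0..} \<and>
     emeasure \<mu> {0} = 0 \<and>
     (\<forall>t>0. (\<integral>\<^sup>+x\<in>{0..}. ennreal (exp (- t * x)) \<partial>\<mu>) < \<infinity>)}"

definition measure_atom :: "'a measure \<Rightarrow> 'a set \<Rightarrow> bool" where
  "measure_atom \<mu> A \<longleftrightarrow> A \<in> sets \<mu> \<and> emeasure \<mu> A > 0 \<and>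
     (\<forall>B\<in>sets \<mu>. B \<subseteq> A \<longrightarrow> emeasure \<mu> B < emeasure \<mu> A \<longrightarrow> emeasure \<mu> B = 0)"

definition purely_atomic :: "'a measure \<Rightarrow> bool" where
  "purely_atomic \<mu> \<longleftrightarrow>
     (\<forall>E\<in>sets \<mu>. emeasure \<mu> E > 0 \<longrightarrow> (\<exists>A\<subseteq>E. measure_atom \<mu> A))"


section \<open>Hankel operators\<close>

lift_definition laplace :: "l2 \<Rightarrow> real \<Rightarrow> complex" is
  "\<lambda>f x. LINT t|halfline. of_real (exp (- t * x)) * f t"
proof (intro ext)
  fix f g :: "real \<Rightarrow> complex" and x :: real
  assume fg: "l2_rel f g"
  then have [measurable]: "f \<in> borel_measurable halfline" "g \<in> borel_measurable halfline"
    by (auto simp: l2_rel_def square_integrable_def)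
  have [measurable]: "(\<lambda>t. complex_of_real (exp (- t * x))) \<in> borel_measurable halfline"
    by (rule measurable_restrict_space1) measurable
  have "AE t in halfline. of_real (exp (- t * x)) * f t = of_real (exp (- t * x)) * g t"
    using fg by (auto simp: l2_rel_def elim: eventually_mono)
  then show "(LINT t|halfline. of_real (exp (- t * x)) * f t) =
        (LINT t|halfline. of_real (exp (- t * x)) * g t)"
    by (intro integral_cong_AE) measurable
qed

definition hankel_form_domain :: "real measure \<Rightarrow> l2 set" where
  "hankel_form_domain \<mu> = {f. (\<integral>\<^sup>+x\<in>{0<..}. ennreal ((norm (laplace f x))\<^sup>2) \<partial>\<mu>) < \<infinity>}"

text \<open>
  The sesquilinear form that polarizes \<open>Q\<^sub>\<mu>[f] = \<integral> |\<L>f|\<^sup>2 d\<mu>\<close>.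
\<close>

definition hankel_form :: "real measure \<Rightarrow> l2 \<Rightarrow> l2 \<Rightarrow> complex" where
  "hankel_form \<mu> f h = (LINT x:{0<..}|\<mu>. laplace f x * cnj (laplace h x))"

definition hankel_operator :: "real measure \<Rightarrow> (l2 \<times> l2) set" where
  "hankel_operator \<mu> = form_operator (hankel_form_domain \<mu>) (hankel_form \<mu>)"

end

theory Submission
  imports Defs "HOL-Probability.Sinc_Integral"
begin

text \<open>
  Testing the form against \<open>f\<close> itself shows that the kernel of the Hankel operator consists of
  the \<open>f\<close> whose Laplace transform \<open>\<L>f\<close> vanishes \<open>\<mu>\<close>-almost everywhere. So everything depends on how
  large a set of zeros on the half-line a non-zero \<open>\<L>f\<close> can have. Both answers come from one
  explicit Hilbert space computation, the one behind the Muentz-Szasz theorem, which takes the place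
  of the theory of Hardy spaces on the right half-plane.

  Write \<open>e\<^sub>a(t) = exp(-a t)\<close>, so that \<open>\<L>f(a)\<close> is the pairing of \<open>f\<close> with \<open>e\<^sub>a\<close>. For a finite set \<open>F\<close> of
  positive reals and \<open>b > 0\<close> outside \<open>F\<close>, partial fractions give a combination \<open>r\<close> of the
  \<open>e\<^sub>a\<close>, \<open>a \<in> F\<close>, and of \<open>e\<^sub>b\<close> with coefficient \<open>1\<close>, whose Laplace transform is
  \<open>B(b) B(x) / (x + b)\<close>, where \<open>B(x) = \<Prod>\<^sub>a (x - a) / (x + a)\<close> is the finite Blaschke product. As it
  vanishes on \<open>F\<close>, \<open>r\<close> is the component of \<open>e\<^sub>b\<close> orthogonal to the span of the \<open>e\<^sub>a\<close>, and its squared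
  norm is \<open>B(b)\<^sup>2 / (2 b)\<close>.

  \<^item> If \<open>\<L>f\<close> vanishes on \<open>F\<close>, then \<open>\<L>f(b)\<close> is the pairing of \<open>f\<close> with \<open>r\<close>, so
    \<open>|\<L>f(b)|\<^sup>2 \<le> \<parallel>f\<parallel>\<^sup>2 B(b)\<^sup>2 / (2 b)\<close> (\<open>laplace_integral_blaschke_bound\<close>). If \<open>\<L>f(b) \<noteq> 0\<close>, this keeps
    \<open>B(b)\<close> away from zero for all finite sets \<open>F\<close> of zeros, which is the Blaschke condition for the
    set of all zeros (\<open>laplace_integral_zeros_summable\<close>).
  \<^item> If \<open>A\<close> satisfies the Blaschke condition, then \<open>B(b)\<close> stays away from zero as \<open>F\<close> increases
    to \<open>A\<close>. The functions \<open>r\<close> form a Cauchy sequence, and the transform of their limit vanishes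
    on \<open>A\<close> but not at \<open>b\<close> (\<open>laplace_integral_interpolation\<close>).

  Now let the kernel contain some \<open>f \<noteq> 0\<close>. The Laplace transform is injective, so \<open>\<L>f(b) \<noteq> 0\<close> for
  some \<open>b > 0\<close>, the zeros of \<open>\<L>f\<close> form a countable Blaschke set, and \<open>\<mu>\<close> lives on it; a measure
  carried by a countable set is purely atomic. Conversely, let \<open>\<mu>\<close> live on a Blaschke sequence. The
  Blaschke condition survives adding finitely many points, so for any finite set \<open>C\<close> of further
  points there are elements of the kernel whose transforms separate the points of \<open>C\<close>; hence
  the kernel is infinite-dimensional. Together, a non-trivial kernel forces the condition on \<open>\<mu>\<close>, and
  the condition forces an infinite-dimensional kernel.
\<close>

section \<open>The Laplace transform of a function\<close>

text \<open>
  The Laplace transform on representatives; \<open>laplace\<close> is its descent to classes.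
\<close>

definition laplace_integral :: "(real \<Rightarrow> complex) \<Rightarrow> real \<Rightarrow> complex" where
  "laplace_integral f x = (LINT t|halfline. of_real (exp (- t * x)) * f t)"

lemma halfline_exp:
  assumes "x > 0"
  shows "integrable halfline (\<lambda>t. exp (- t * x))" "(LINT t|halfline. exp (- t * x)) = 1 / x"
  using integrable_I0i_exp_mscale[OF assms] LBINT_I0i_exp_mscale[OF assms]
  by (simp_all add: integrable_restrict_space integral_restrict_space set_integrable_def
      interval_lebesgue_integral_0_infty set_lebesgue_integral_def)

section \<open>Pairing square-integrable functions\<close>

lemma square_integrable_mult:
  assumes "square_integrable f" "square_integrable g"
  shows "integrable halfline (\<lambda>t. f t * g t)"
proof (rule Bochner_Integration.integrable_bound)
  have [measurable]: "f \<in> borel_measurable halfline" "g \<in> borel_measurable halfline"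
    using assms by (auto simp: square_integrable_def)
  show "integrable halfline (\<lambda>t. (norm (f t))\<^sup>2 + (norm (g t))\<^sup>2)"
    using assms by (auto simp: square_integrable_def)
  show "(\<lambda>t. f t * g t) \<in> borel_measurable halfline"
    by measurable
  have "norm (f t * g t) \<le> norm ((norm (f t))\<^sup>2 + (norm (g t))\<^sup>2)" for t
    using sum_squares_bound[of "norm (f t)" "norm (g t)"] mult_nonneg_nonneg[OF norm_ge_zero[of "f t"] norm_ge_zero[of "g t"]]
    unfolding norm_mult real_norm_def by linarith
  then show "AE t in halfline. norm (f t * g t) \<le> norm ((norm (f t))\<^sup>2 + (norm (g t))\<^sup>2)"
    by simp
qed

lemma square_integrable_Cauchy_Schwarz:
  assumes "square_integrable f" "square_integrable g"
  shows "(norm (LINT t|halfline. f t * g t))\<^sup>2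
           \<le> (LINT t|halfline. (norm (f t))\<^sup>2) * (LINT t|halfline. (norm (g t))\<^sup>2)"
proof -
  have [measurable]: "f \<in> borel_measurable halfline" "g \<in> borel_measurable halfline"
    and int: "integrable halfline (\<lambda>t. (norm (f t))\<^sup>2)" "integrable halfline (\<lambda>t. (norm (g t))\<^sup>2)"
    using assms by (auto simp: square_integrable_def)
  have fg: "integrable halfline (\<lambda>t. norm (f t) * norm (g t))"
    using integrable_norm[OF square_integrable_mult[OF assms]] by (simp add: norm_mult)
  have "ennreal ((LINT t|halfline. norm (f t) * norm (g t))\<^sup>2)
      = (\<integral>\<^sup>+t. ennreal (norm (f t)) * ennreal (norm (g t)) \<partial>halfline)\<^sup>2"
    using fg by (simp add: ennreal_mult[symmetric] nn_integral_eq_integral ennreal_power)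
  also have "\<dots> \<le> (\<integral>\<^sup>+t. (ennreal (norm (f t)))\<^sup>2 \<partial>halfline) * (\<integral>\<^sup>+t. (ennreal (norm (g t)))\<^sup>2 \<partial>halfline)"
    by (rule Cauchy_Schwarz_nn_integral) measurable
  also have "\<dots> = ennreal ((LINT t|halfline. (norm (f t))\<^sup>2) * (LINT t|halfline. (norm (g t))\<^sup>2))"
    using int by (simp add: ennreal_power nn_integral_eq_integral ennreal_mult[symmetric])
  finally have "(LINT t|halfline. norm (f t) * norm (g t))\<^sup>2
           \<le> (LINT t|halfline. (norm (f t))\<^sup>2) * (LINT t|halfline. (norm (g t))\<^sup>2)"
    by (simp add: ennreal_le_iff)
  moreover have "norm (LINT t|halfline. f t * g t) \<le> (LINT t|halfline. norm (f t) * norm (g t))"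
    using integral_norm_bound[of halfline "\<lambda>t. f t * g t"] by (simp add: norm_mult)
  ultimately show ?thesis
    by (meson norm_ge_zero order_trans power_mono)
qed

lemma square_integrable_exp:
  assumes "x > 0"
  shows "square_integrable (\<lambda>t. of_real (exp (- t * x)))"
proof -
  have "(\<lambda>t. (norm (complex_of_real (exp (- t * x))))\<^sup>2) = (\<lambda>t. exp (- t * (2 * x)))"
    by (auto simp flip: exp_double)
  moreover have "(\<lambda>t. complex_of_real (exp (- t * x))) \<in> borel_measurable halfline"
    by (rule measurable_restrict_space1) measurable
  ultimately show ?thesis
    using halfline_exp(1)[of "2 * x"] assms by (simp add: square_integrable_def)
qed

lemma laplace_integrable:
  assumes "square_integrable f" "x > 0"
  shows "integrable halfline (\<lambda>t. of_real (exp (- t * x)) * f t)"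
  using square_integrable_mult[OF square_integrable_exp[OF assms(2)] assms(1)] .

section \<open>Combinations of exponentials and finite Blaschke products\<close>

definition exp_combination :: "real set \<Rightarrow> (real \<Rightarrow> real) \<Rightarrow> real \<Rightarrow> complex" where
  "exp_combination F c t = (\<Sum>a\<in>F. of_real (c a) * of_real (exp (- t * a)))"

lemma square_integrable_exp_combination:
  assumes "finite F" "F \<subseteq> {0<..}"
  shows "square_integrable (exp_combination F c)"
  using assms
proof (induction F rule: finite_induct)
  case empty
  then show ?case by (simp add: exp_combination_def square_integrable_zero)
next
  case (insert a F)
  have "exp_combination (insert a F) c = (\<lambda>t. of_real (c a) * of_real (exp (- t * a)) + exp_combination F c t)"
    using insert by (auto simp: exp_combination_def)
  then show ?case
    using insert square_integrable_add[OF square_integrable_scale[OF square_integrable_exp]]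
    by simp
qed

lemma integral_exp_sum_mult:
  assumes "finite F" "F \<subseteq> {0<..}" "square_integrable f"
  shows "(LINT t|halfline. exp_combination F c t * f t) = (\<Sum>a\<in>F. of_real (c a) * laplace_integral f a)"
proof -
  have "(LINT t|halfline. exp_combination F c t * f t)
      = (LINT t|halfline. (\<Sum>a\<in>F. of_real (c a) * (of_real (exp (- t * a)) * f t)))"
    by (simp add: exp_combination_def sum_distrib_right mult.assoc)
  also have "\<dots> = (\<Sum>a\<in>F. LINT t|halfline. of_real (c a) * (of_real (exp (- t * a)) * f t))"
    using assms by (intro Bochner_Integration.integral_sum integrable_mult_right laplace_integrable) (auto dest: subsetD)
  also have "\<dots> = (\<Sum>a\<in>F. of_real (c a) * laplace_integral f a)"
    by (simp add: laplace_integral_def)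
  finally show ?thesis .
qed

lemma laplace_integral_exp:
  assumes "x > 0" "a > 0"
  shows "laplace_integral (\<lambda>t. of_real (exp (- t * a))) x = of_real (1 / (x + a))"
proof -
  have "(\<lambda>t. complex_of_real (exp (- t * x)) * of_real (exp (- t * a)))
      = (\<lambda>t. complex_of_real (exp (- t * (x + a))))"
    by (simp add: algebra_simps flip: of_real_mult exp_add)
  then show ?thesis
    unfolding laplace_integral_def using halfline_exp(2)[of "x + a"] assms by simp
qed

lemma laplace_integral_exp_combination:
  assumes "finite F" "F \<subseteq> {0<..}" "x > 0"
  shows "laplace_integral (exp_combination F c) x = of_real (\<Sum>a\<in>F. c a / (x + a))"
proof -
  have "laplace_integral (exp_combination F c) x
      = (LINT t|halfline. exp_combination F c t * of_real (exp (- t * x)))"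
    by (simp add: laplace_integral_def mult.commute)
  also have "\<dots> = (\<Sum>a\<in>F. of_real (c a) * of_real (1 / (a + x)))"
    unfolding integral_exp_sum_mult[OF assms(1,2) square_integrable_exp[OF assms(3)]]
    using assms by (intro sum.cong) (auto simp only: laplace_integral_exp greaterThan_iff)
  finally show ?thesis
    by (simp add: add.commute)
qed

text \<open>
  The finite Blaschke product of the right half-plane with simple zeros at the points of
  \<open>F\<close>, restricted to the real axis.
\<close>

definition blaschke :: "real set \<Rightarrow> real \<Rightarrow> real" where
  "blaschke F x = (\<Prod>a\<in>F. (x - a) / (x + a))"

text \<open>
  The right-hand side is a rational function of degree \<open>-1\<close> in \<open>x\<close> with simple poles at the points
  \<open>-a\<close>, so it has such an expansion; the factor \<open>B(b)\<close>, with \<open>B\<close> the Blaschke product of \<open>F\<close>,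
  normalizes the residue at \<open>-b\<close> to \<open>1\<close>.
  Adding a point \<open>d\<close> multiplies every term by \<open>(x - d) / (x + d)\<close>, and
  \<open>(x - d) / ((x + d) (x + a)) = \<alpha> / (x + a) + \<beta> / (x + d)\<close> with \<open>\<alpha> = (a + d) / (a - d)\<close> and
  \<open>\<beta> = - 2 d / (a - d)\<close>.
\<close>

lemma partial_fractions:
  fixes b :: real
  assumes "finite F" "F \<subseteq> {0<..}" "b > 0" "b \<notin> F"
  shows "\<exists>c. c b = 1 \<and>
    (\<forall>x>0. (\<Sum>a\<in>insert b F. c a / (x + a)) = blaschke F b * blaschke F x / (x + b))"
  using assms
proof (induction F rule: finite_induct)
  case empty
  then show ?case by (auto simp: blaschke_def intro!: exI[of _ "\<lambda>_. 1"])
next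
  case (insert d F)
  let ?G = "insert b F"
  have d: "d > 0" "d \<noteq> b" "d \<notin> ?G" "finite ?G" and pos: "\<And>a. a \<in> ?G \<Longrightarrow> a > 0"
    using insert by auto
  obtain c where cb: "c b = 1" and
    c: "\<And>x. x > 0 \<Longrightarrow> (\<Sum>a\<in>?G. c a / (x + a)) = blaschke F b * blaschke F x / (x + b)"
    using insert by auto
  define k where "k = (b - d) / (b + d)"
  define c' where "c' a = (if a = d then k * (\<Sum>a\<in>?G. c a * (- 2 * d) / (a - d))
                            else k * c a * (a + d) / (a - d))" for a
  have "c' b = 1"
    using d pos[of b] cb by (simp add: c'_def k_def)
  moreover have "(\<Sum>a\<in>insert b (insert d F). c' a / (x + a))
      = blaschke (insert d F) b * blaschke (insert d F) x / (x + b)" if "x > 0" for x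
  proof -
    have step: "k * c a * (a + d) / (a - d) / (x + a) + k * (c a * (- 2 * d) / (a - d)) / (x + d)
        = k * ((x - d) / (x + d)) * (c a / (x + a))" if "a \<in> ?G" for a
    proof -
      have "a - d \<noteq> 0" "x + a \<noteq> 0" "x + d \<noteq> 0"
        using that d pos[of a] \<open>x > 0\<close> by auto
      then show ?thesis
        by (simp add: divide_simps) (simp add: algebra_simps)
    qed
    have "(\<Sum>a\<in>insert b (insert d F). c' a / (x + a)) = (\<Sum>a\<in>insert d ?G. c' a / (x + a))"
      by (simp add: insert_commute)
    also have "\<dots> = c' d / (x + d) + (\<Sum>a\<in>?G. c' a / (x + a))"
      using d by simp
    also have "(\<Sum>a\<in>?G. c' a / (x + a)) = (\<Sum>a\<in>?G. k * c a * (a + d) / (a - d) / (x + a))"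
      using d by (intro sum.cong) (auto simp: c'_def)
    also have "c' d / (x + d) + \<dots> =
        (\<Sum>a\<in>?G. k * c a * (a + d) / (a - d) / (x + a) + k * (c a * (- 2 * d) / (a - d)) / (x + d))"
      unfolding sum.distrib by (simp add: c'_def sum_distrib_left sum_divide_distrib del: sum.insert)
    also have "\<dots> = (\<Sum>a\<in>?G. k * ((x - d) / (x + d)) * (c a / (x + a)))"
      by (intro sum.cong refl step)
    also have "\<dots> = k * ((x - d) / (x + d)) * (\<Sum>a\<in>?G. c a / (x + a))"
      by (simp only: sum_distrib_left)
    also have "\<dots> = blaschke (insert d F) b * blaschke (insert d F) x / (x + b)"
      using insert \<open>x > 0\<close> by (simp only: c) (simp add: blaschke_def k_def)
    finally show ?thesis .
  qed
  ultimately show ?case by blast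
qed

lemma laplace_integral_diff:
  assumes "square_integrable f" "square_integrable g" "x > 0"
  shows "laplace_integral (\<lambda>t. f t - g t) x = laplace_integral f x - laplace_integral g x"
  unfolding laplace_integral_def right_diff_distrib
  by (intro Bochner_Integration.integral_diff laplace_integrable assms)

section \<open>The residual of an exponential\<close>

text \<open>
  \<open>r\<close> is the component of \<open>exp(-b t)\<close> orthogonal to the span of the \<open>exp(-a t)\<close>, \<open>a \<in> F\<close>. The
  definition records it through its partial fraction expansion, from which orthogonality follows
  since the transform vanishes on \<open>F\<close>.
\<close>

definition exp_residual :: "real set \<Rightarrow> real \<Rightarrow> (real \<Rightarrow> complex) \<Rightarrow> bool" where
  "exp_residual F b r \<longleftrightarrow> (\<exists>c. c b = 1 \<and> r = exp_combination (insert b F) c \<and>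
     (\<forall>x>0. (\<Sum>a\<in>insert b F. c a / (x + a)) = blaschke F b * blaschke F x / (x + b)))"

context
  fixes F :: "real set" and b :: real
  assumes F: "finite F" "F \<subseteq> {0<..}" and b: "b > 0" "b \<notin> F"
begin

lemma exp_residual_exists: "\<exists>r. exp_residual F b r"
  using partial_fractions[OF F b] unfolding exp_residual_def by blast

lemma square_integrable_exp_residual: "exp_residual F b r \<Longrightarrow> square_integrable r"
  using F b by (auto simp: exp_residual_def intro!: square_integrable_exp_combination)

lemma exp_residual_real: "exp_residual F b r \<Longrightarrow> r t \<in> \<real>"
  by (auto simp: exp_residual_def exp_combination_def intro!: sum_in_Reals Reals_mult)

lemma laplace_integral_exp_residual:
  assumes "exp_residual F b r" "x > 0"
  shows "laplace_integral r x = of_real (blaschke F b * blaschke F x / (x + b))"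
proof -
  obtain c where r: "r = exp_combination (insert b F) c"
    and c: "\<And>x. x > 0 \<Longrightarrow> (\<Sum>a\<in>insert b F. c a / (x + a)) = blaschke F b * blaschke F x / (x + b)"
    using assms by (auto simp: exp_residual_def)
  have "laplace_integral r x = of_real (\<Sum>a\<in>insert b F. c a / (x + a))"
    unfolding r using F b assms by (intro laplace_integral_exp_combination) auto
  then show ?thesis
    using c assms by simp
qed

text \<open>
  All terms of \<open>r\<close> except \<open>exp(-b t)\<close> pair to zero with \<open>f\<close>. So pairing with \<open>r\<close> evaluates \<open>\<L>f\<close> at
  \<open>b\<close> just as pairing with \<open>exp(-b t)\<close> does, but \<open>r\<close> has the smaller norm.
\<close>

lemma exp_residual_reproducing:
  assumes r: "exp_residual F b r" and f: "square_integrable f"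
    and zero: "\<And>a. a \<in> F \<Longrightarrow> laplace_integral f a = 0"
  shows "(LINT t|halfline. r t * f t) = laplace_integral f b"
proof -
  obtain c where r: "r = exp_combination (insert b F) c" and c: "c b = 1"
    using r by (auto simp: exp_residual_def)
  have "(LINT t|halfline. r t * f t) = (\<Sum>a\<in>insert b F. of_real (c a) * laplace_integral f a)"
    unfolding r using F b f by (intro integral_exp_sum_mult) auto
  also have "\<dots> = laplace_integral f b"
    using F b c zero by simp
  finally show ?thesis .
qed

end

lemma blaschke_zero: "finite F \<Longrightarrow> a \<in> F \<Longrightarrow> blaschke F a = 0"
  by (auto simp: blaschke_def)

text \<open>
  The transform of \<open>s\<close> vanishes on \<open>G\<close>, hence on \<open>F\<close>, so the reproducing property of \<open>r\<close> applies to
  \<open>s\<close>. The value is independent of \<open>F\<close> because \<open>r\<close> and \<open>s\<close> are orthogonal projections of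
  the same vector, the second onto a smaller space.
\<close>

lemma exp_residual_inner:
  assumes FG: "finite G" "F \<subseteq> G" "G \<subseteq> {0<..}" "b > 0" "b \<notin> G"
    and r: "exp_residual F b r" and s: "exp_residual G b s"
  shows "(LINT t|halfline. r t * s t) = of_real ((blaschke G b)\<^sup>2 / (2 * b))"
proof -
  have F: "finite F" "F \<subseteq> {0<..}" "b \<notin> F"
    using FG finite_subset by auto
  have ls: "laplace_integral s x = of_real (blaschke G b * blaschke G x / (x + b))" if "x > 0" for x
    using laplace_integral_exp_residual[OF FG(1,3-5) s that] .
  have "(LINT t|halfline. r t * s t) = laplace_integral s b"
  proof (rule exp_residual_reproducing[OF F(1,2) \<open>b > 0\<close> F(3) r])
    show "square_integrable s"
      using square_integrable_exp_residual[OF FG(1,3-5) s] .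
    show "laplace_integral s a = 0" if "a \<in> F" for a
      using that FG by (subst ls) (auto simp: blaschke_zero)
  qed
  then show ?thesis
    using ls[of b] FG by (simp add: power2_eq_square)
qed

lemma exp_residual_norm_diff:
  assumes FG: "finite G" "F \<subseteq> G" "G \<subseteq> {0<..}" "b > 0" "b \<notin> G"
    and r: "exp_residual F b r" and s: "exp_residual G b s"
  shows "(LINT t|halfline. (norm (r t - s t))\<^sup>2) = ((blaschke F b)\<^sup>2 - (blaschke G b)\<^sup>2) / (2 * b)"
proof -
  have F: "finite F" "F \<subseteq> {0<..}" "b \<notin> F"
    using FG finite_subset by auto
  have sq: "square_integrable r" "square_integrable s"
    using square_integrable_exp_residual F FG r s by blast+
  note int = square_integrable_mult[OF sq(1,1)] square_integrable_mult[OF sq(1,2)]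
    square_integrable_mult[OF sq(2,2)]
  have "complex_of_real ((norm (r t - s t))\<^sup>2) = r t * r t - 2 * (r t * s t) + s t * s t" for t
  proof -
    have "r t - s t \<in> \<real>"
      using exp_residual_real F FG r s by (intro Reals_diff) blast+
    then obtain y where y: "r t - s t = of_real y"
      by (auto elim: Reals_cases)
    have "r t * r t - 2 * (r t * s t) + s t * s t = (r t - s t) * (r t - s t)"
      by (simp add: algebra_simps)
    then show ?thesis
      unfolding y by (simp add: power2_eq_square)
  qed
  then have "complex_of_real (LINT t|halfline. (norm (r t - s t))\<^sup>2)
      = (LINT t|halfline. r t * r t - 2 * (r t * s t) + s t * s t)"
    unfolding integral_complex_of_real[symmetric] by simp
  also have "\<dots> = (LINT t|halfline. r t * r t) - 2 * (LINT t|halfline. r t * s t)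
      + (LINT t|halfline. s t * s t)"
    using int by simp
  also have "\<dots> = of_real (((blaschke F b)\<^sup>2 - (blaschke G b)\<^sup>2) / (2 * b))"
    using exp_residual_inner[OF F(1) order_refl F(2) \<open>b > 0\<close> F(3) r r]
      exp_residual_inner[OF FG r s] exp_residual_inner[OF FG(1) order_refl FG(3-5) s s]
    by (simp add: diff_divide_distrib)
  finally show ?thesis
    unfolding of_real_eq_iff .
qed

section \<open>Zeros of a Laplace transform satisfy the Blaschke condition\<close>

text \<open>
  The reproducing property of the residual combined with the Cauchy-Schwarz inequality.
\<close>

lemma laplace_integral_blaschke_bound:
  assumes F: "finite F" "F \<subseteq> {0<..}" and b: "b > 0" "b \<notin> F" and f: "square_integrable f"
    and zero: "\<And>a. a \<in> F \<Longrightarrow> laplace_integral f a = 0"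
  shows "(norm (laplace_integral f b))\<^sup>2
           \<le> (blaschke F b)\<^sup>2 / (2 * b) * (LINT t|halfline. (norm (f t))\<^sup>2)"
proof -
  obtain r where r: "exp_residual F b r"
    using exp_residual_exists[OF F b] by blast
  have "(norm (r t))\<^sup>2 = Re (r t * r t)" for t
    using exp_residual_real[OF F b r, of t] by (auto elim!: Reals_cases simp: power2_eq_square)
  then have "(LINT t|halfline. (norm (r t))\<^sup>2) = Re (LINT t|halfline. r t * r t)"
    using square_integrable_exp_residual[OF F b r] by (simp add: square_integrable_mult del: times_complex.simps)
  also have "\<dots> = (blaschke F b)\<^sup>2 / (2 * b)"
    unfolding exp_residual_inner[OF F(1) order_refl F(2) b r r] by (rule Re_complex_of_real)
  finally show ?thesis
    using square_integrable_Cauchy_Schwarz[OF square_integrable_exp_residual[OF F b r] f]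
    by (simp only: exp_residual_reproducing[OF F b r f zero])
qed

text \<open>
  Squaring removes the signs of the factors and turns the product into one of the shape
  \<open>\<Prod>(1 - d\<^sub>a)\<close> with \<open>d\<^sub>a \<in> [0, 1]\<close>, whose size is governed by \<open>\<Sum>d\<^sub>a\<close>.
\<close>

lemma blaschke_sq:
  assumes "F \<subseteq> {0<..}" "b > 0"
  shows "(blaschke F b)\<^sup>2 = (\<Prod>a\<in>F. 1 - 4 * a * b / (a + b)\<^sup>2)"
  unfolding blaschke_def prod_power_distrib
proof (rule prod.cong)
  fix a assume "a \<in> F"
  then have "a + b \<noteq> 0" "b + a \<noteq> 0"
    using assms by (auto dest!: subsetD)
  moreover have "(a + b)\<^sup>2 - 4 * a * b = (b - a)\<^sup>2"
    by (simp add: power2_eq_square algebra_simps)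
  ultimately show "((b - a) / (b + a))\<^sup>2 = 1 - 4 * a * b / (a + b)\<^sup>2"
    unfolding power_divide add.commute[of b a] by (simp add: diff_divide_distrib flip: \<open>_ = (b - a)\<^sup>2\<close>)
qed simp

text \<open>
  For fixed \<open>b\<close>, the defects \<open>1 - ((b - a) / (b + a))\<^sup>2\<close> are comparable with the Blaschke weights
  \<open>a / (a\<^sup>2 + 1)\<close>. Both comparisons amount to \<open>(a + b)\<^sup>2\<close> and \<open>a\<^sup>2 + 1\<close> being comparable up to constants
  that depend only on \<open>b\<close>.
\<close>

lemma blaschke_defect_bounds:
  fixes a b :: real
  assumes "a > 0" "b > 0"
  shows "a / (a\<^sup>2 + 1) \<le> (1 + b\<^sup>2) / (2 * b) * (4 * a * b / (a + b)\<^sup>2)"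
    and "4 * a * b / (a + b)\<^sup>2 \<le> 4 * b * (1 + 1 / b\<^sup>2) * (a / (a\<^sup>2 + 1))"
    and "4 * a * b / (a + b)\<^sup>2 \<in> {0..1}"
proof -
  have pos: "(a + b)\<^sup>2 > 0" "a\<^sup>2 + 1 > 0"
    using assms by (auto simp: add_pos_pos)
  have "(a + b)\<^sup>2 \<le> 2 * a\<^sup>2 + 2 * b\<^sup>2"
    using sum_squares_bound[of a b] by (simp add: power2_sum)
  also have "\<dots> \<le> 2 * (1 + b\<^sup>2) * (a\<^sup>2 + 1)"
    by (simp add: algebra_simps)
  finally have "a * (a + b)\<^sup>2 \<le> a * (2 * (1 + b\<^sup>2) * (a\<^sup>2 + 1))"
    using assms by (intro mult_left_mono) auto
  moreover have "(1 + b\<^sup>2) / (2 * b) * (4 * a * b / (a + b)\<^sup>2) = a * (2 * (1 + b\<^sup>2)) / (a + b)\<^sup>2"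
    using assms by simp
  ultimately show "a / (a\<^sup>2 + 1) \<le> (1 + b\<^sup>2) / (2 * b) * (4 * a * b / (a + b)\<^sup>2)"
    using pos by (simp add: divide_le_eq pos_le_divide_eq mult.assoc)
  have "a\<^sup>2 + 1 \<le> (1 + 1 / b\<^sup>2) * (a\<^sup>2 + b\<^sup>2)"
    using assms by (simp add: field_simps)
  also have "\<dots> \<le> (1 + 1 / b\<^sup>2) * (a + b)\<^sup>2"
    using assms by (intro mult_left_mono) (auto simp: power2_sum)
  finally have "4 * a * b * (a\<^sup>2 + 1) \<le> 4 * a * b * ((1 + 1 / b\<^sup>2) * (a + b)\<^sup>2)"
    using assms by (intro mult_left_mono) auto
  then show "4 * a * b / (a + b)\<^sup>2 \<le> 4 * b * (1 + 1 / b\<^sup>2) * (a / (a\<^sup>2 + 1))"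
    using pos by (simp add: divide_le_eq pos_le_divide_eq mult_ac)
  have "4 * a * b \<le> (a + b)\<^sup>2"
    using sum_squares_bound[of a b] by (simp add: power2_sum)
  then show "4 * a * b / (a + b)\<^sup>2 \<in> {0..1}"
    using assms pos by simp
qed

text \<open>
  For a finite set \<open>F\<close> of zeros, \<open>\<Prod>(1 - d\<^sub>a) \<le> exp(- \<Sum>d\<^sub>a)\<close> turns the bound on \<open>\<L>f(b)\<close> into an upper bound
  on \<open>\<Sum>d\<^sub>a\<close> that does not depend on \<open>F\<close>.
\<close>

lemma laplace_integral_zeros_summable:
  assumes f: "square_integrable f" and b: "b > 0" "laplace_integral f b \<noteq> 0"
  shows "(\<lambda>a. a / (a\<^sup>2 + 1)) summable_on {a. a > 0 \<and> laplace_integral f a = 0}" (is "_ summable_on ?Z")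
proof (rule nonneg_bdd_above_summable_on)
  define d where "d a = 4 * a * b / (a + b)\<^sup>2" for a
  define N where "N = (LINT t|halfline. (norm (f t))\<^sup>2) / (2 * b)"
  define n where "n = (norm (laplace_integral f b))\<^sup>2"
  have "n > 0"
    using b by (simp add: n_def)
  have N: "N \<ge> 0"
    using b by (simp add: N_def)
  have "sum (\<lambda>a. a / (a\<^sup>2 + 1)) F \<le> (1 + b\<^sup>2) / (2 * b) * (N / n)" if F: "F \<subseteq> ?Z" "finite F" for F
  proof -
    have Fpos: "F \<subseteq> {0<..}" "b \<notin> F"
      using F b by auto
    have "n \<le> (blaschke F b)\<^sup>2 * N"
      using laplace_integral_blaschke_bound[OF F(2) Fpos(1) b(1) Fpos(2) f] F
      by (auto simp: n_def N_def)
    also have "(blaschke F b)\<^sup>2 = (\<Prod>a\<in>F. 1 - d a)"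
      unfolding d_def by (rule blaschke_sq[OF Fpos(1) b(1)])
    also have "\<dots> \<le> (\<Prod>a\<in>F. exp (- d a))"
    proof (rule prod_mono)
      fix a assume "a \<in> F"
      then have "a > 0" using Fpos by auto
      then show "0 \<le> 1 - d a \<and> 1 - d a \<le> exp (- d a)"
        using blaschke_defect_bounds(3)[of a b] b exp_ge_add_one_self[of "- d a"] by (auto simp: d_def)
    qed
    also have "\<dots> = exp (- sum d F)"
      using F by (simp add: exp_sum[symmetric] sum_negf[symmetric])
    finally have "n \<le> exp (- sum d F) * N"
      using N by (simp add: mult_right_mono)
    then have "n * exp (sum d F) \<le> N"
      by (simp add: exp_minus field_simps)
    moreover have "n * sum d F \<le> n * exp (sum d F)"
      using \<open>n > 0\<close> exp_ge_add_one_self[of "sum d F"] by (intro mult_left_mono; linarith)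
    ultimately have "n * sum d F \<le> N"
      by linarith
    then have "sum d F \<le> N / n"
      using \<open>n > 0\<close> by (simp add: pos_le_divide_eq mult.commute)
    have "sum (\<lambda>a. a / (a\<^sup>2 + 1)) F \<le> sum (\<lambda>a. (1 + b\<^sup>2) / (2 * b) * d a) F"
      unfolding d_def using Fpos b by (intro sum_mono blaschke_defect_bounds(1)) auto
    also have "\<dots> = (1 + b\<^sup>2) / (2 * b) * sum d F"
      by (simp add: sum_distrib_left)
    also have "\<dots> \<le> (1 + b\<^sup>2) / (2 * b) * (N / n)"
      using \<open>sum d F \<le> N / n\<close> b by (intro mult_left_mono) auto
    finally show ?thesis .
  qed
  then show "bdd_above (sum (\<lambda>a. a / (a\<^sup>2 + 1)) ` {F. F \<subseteq> ?Z \<and> finite F})"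
    by (intro bdd_aboveI2[where M = "(1 + b\<^sup>2) / (2 * b) * (N / n)"]) auto
qed auto

section \<open>Interpolation on a Blaschke set\<close>

lemma countable_if_summable:
  fixes A :: "real set"
  assumes "A \<subseteq> {0<..}" "(\<lambda>a. a / (a\<^sup>2 + 1)) summable_on A"
  shows "countable A"
proof (rule countable_subset)
  show "countable {a \<in> A. a / (a\<^sup>2 + 1) \<noteq> 0}"
    using assms(2) by (rule summable_countable_real)
  have "a / (a\<^sup>2 + 1) \<noteq> 0" if "a > 0" for a :: real
    using that by (simp add: add_nonneg_eq_0_iff)
  then show "A \<subseteq> {a \<in> A. a / (a\<^sup>2 + 1) \<noteq> 0}"
    using assms(1) by auto
qed

lemma summable_on_tail:
  fixes d :: "'a \<Rightarrow> real"
  assumes "d summable_on A" "e > 0" "\<And>a. a \<in> A \<Longrightarrow> d a \<ge> 0"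
  obtains X where "finite X" "X \<subseteq> A" "\<And>F. finite F \<Longrightarrow> F \<subseteq> A - X \<Longrightarrow> sum d F < e"
proof -
  have "(sum d \<longlongrightarrow> infsum d A) (finite_subsets_at_top A)"
    using assms(1) by (simp add: summable_iff_has_sum_infsum has_sum_def)
  then have "\<forall>\<^sub>F X in finite_subsets_at_top A. infsum d A - e < sum d X"
    using assms(2) by (intro order_tendstoD(1)) auto
  then obtain X where X: "finite X" "X \<subseteq> A" "infsum d A - e < sum d X"
    by (auto simp: eventually_finite_subsets_at_top)
  have "sum d F < e" if F: "finite F" "F \<subseteq> A - X" for F
  proof -
    have "sum d X + sum d F = sum d (X \<union> F)"
      using F X by (intro sum.union_disjoint[symmetric]) auto
    also have "\<dots> \<le> infsum d A"
      using F X assms by (intro finite_sum_le_infsum) auto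
    finally show ?thesis using X by simp
  qed
  then show ?thesis using that X by blast
qed

text \<open>
  Removing a finite set \<open>X\<close> leaves a tail on which the defects add up to less than \<open>1 / 2\<close>, so there
  \<open>\<Prod>(1 - d\<^sub>a) \<ge> 1 - \<Sum>d\<^sub>a \<ge> 1 / 2\<close>. The product over \<open>X\<close> is non-zero since \<open>b \<notin> A\<close>.
\<close>

lemma blaschke_bounded_below:
  assumes A: "A \<subseteq> {0<..}" "(\<lambda>a. a / (a\<^sup>2 + 1)) summable_on A" and b: "b > 0" "b \<notin> A"
  shows "\<exists>\<delta>>0. \<forall>F. finite F \<longrightarrow> F \<subseteq> A \<longrightarrow> \<delta> \<le> (blaschke F b)\<^sup>2"
proof -
  define d where "d a = 4 * a * b / (a + b)\<^sup>2" for a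
  have d: "d a \<in> {0..1}" if "a \<in> A" for a
    using blaschke_defect_bounds(3)[of a b] that A b by (auto simp: d_def)
  have "d summable_on A"
  proof (rule summable_on_comparison_test)
    show "(\<lambda>a. 4 * b * (1 + 1 / b\<^sup>2) * (a / (a\<^sup>2 + 1))) summable_on A"
      by (intro summable_on_cmult_right A)
    show "d a \<le> 4 * b * (1 + 1 / b\<^sup>2) * (a / (a\<^sup>2 + 1))" if "a \<in> A" for a
      unfolding d_def using that A b by (intro blaschke_defect_bounds(2)) auto
  qed (use d in auto)
  then obtain X where X: "finite X" "X \<subseteq> A" and tail: "\<And>F. finite F \<Longrightarrow> F \<subseteq> A - X \<Longrightarrow> sum d F < 1 / 2"
    using summable_on_tail[of d A "1 / 2"] d by auto
  have sq: "(blaschke F b)\<^sup>2 = (\<Prod>a\<in>F. 1 - d a)" if "F \<subseteq> A" for F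
    unfolding d_def using A b that by (intro blaschke_sq) auto
  have "blaschke X b \<noteq> 0"
    using X A b by (auto simp: blaschke_def dest!: subsetD)
  show ?thesis
  proof (intro exI[of _ "(blaschke X b)\<^sup>2 / 2"] conjI allI impI)
    show "(blaschke X b)\<^sup>2 / 2 > 0"
      using \<open>blaschke X b \<noteq> 0\<close> by simp
    fix F assume F: "finite F" "F \<subseteq> A"
    have "1 / 2 \<le> 1 - sum d (F - X)"
      using tail[of "F - X"] F by force
    also have "\<dots> \<le> (\<Prod>a\<in>F - X. 1 - d a)"
      using d F by (intro Weierstrass_prod_ineq) auto
    finally have "(blaschke X b)\<^sup>2 / 2 \<le> (\<Prod>a\<in>X. 1 - d a) * (\<Prod>a\<in>F - X. 1 - d a)"
      using mult_left_mono[OF _ zero_le_power2[of "blaschke X b"]] by (fastforce simp flip: sq[OF X(2)])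
    also have "\<dots> = (\<Prod>a\<in>X \<union> F. 1 - d a)"
      using X F by (subst prod.union_disjoint[symmetric]) (auto intro!: prod.cong)
    also have "X \<union> F = F \<union> (X - F)"
      by blast
    also have "(\<Prod>a\<in>F \<union> (X - F). 1 - d a) = (\<Prod>a\<in>F. 1 - d a) * (\<Prod>a\<in>X - F. 1 - d a)"
      using X F by (intro prod.union_disjoint) auto
    also have "\<dots> \<le> (\<Prod>a\<in>F. 1 - d a)"
      using X F d by (intro mult_left_le prod_le_1 prod_nonneg) (auto simp: subset_iff)
    finally show "(blaschke X b)\<^sup>2 / 2 \<le> (blaschke F b)\<^sup>2"
      using F by (simp add: sq)
  qed
qed

text \<open>
  The Riesz-Fischer theorem. Along a fast subsequence the squared norms of the increments \<open>d\<^sub>k\<close> decay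
  like \<open>8\<^sup>-\<^sup>k\<close>, so \<open>\<Sum>\<^sub>k 4\<^sup>k |d\<^sub>k(t)|\<^sup>2\<close> has finite integral and is finite almost everywhere. Hence
  \<open>|d\<^sub>k(t)| \<le> 2\<^sup>-\<^sup>k\<close> eventually, and the subsequence converges pointwise. Fatou's lemma then bounds the
  distance of the sequence from the pointwise limit.
\<close>

lemma square_integrable_complete:
  fixes s :: "nat \<Rightarrow> real \<Rightarrow> complex"
  assumes s: "\<And>n. square_integrable (s n)"
    and Cauchy: "\<And>e. e > 0 \<Longrightarrow> \<exists>N. \<forall>m\<ge>N. \<forall>n\<ge>N. (LINT t|halfline. (norm (s m t - s n t))\<^sup>2) < e"
  obtains g where "square_integrable g" "(\<lambda>n. LINT t|halfline. (norm (s n t - g t))\<^sup>2) \<longlonglongrightarrow> 0"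
proof -
  have s_meas [measurable]: "s n \<in> borel_measurable halfline" for n
    using s by (auto simp: square_integrable_def)
  have s_int: "integrable halfline (\<lambda>t. (norm (s m t - s n t))\<^sup>2)" for m n
    using square_integrable_diff[OF s s] by (auto simp: square_integrable_def)
  have "\<exists>N. \<forall>k. \<forall>m\<ge>N k. \<forall>n\<ge>N k. (LINT t|halfline. (norm (s m t - s n t))\<^sup>2) < (1 / 8) ^ k"
    using Cauchy by (intro choice allI) auto
  then obtain N where N: "\<And>k m n. m \<ge> N k \<Longrightarrow> n \<ge> N k \<Longrightarrow> (LINT t|halfline. (norm (s m t - s n t))\<^sup>2) < (1 / 8) ^ k"
    by blast
  \<comment> \<open>Partial sums keep the indices monotone, and the summand \<open>k\<close> makes them tend to infinity.\<close>
  define \<phi> where "\<phi> k = k + (\<Sum>j\<le>k. N j)" for k :: nat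
  have \<phi>_ge: "k \<le> \<phi> k" "N k \<le> \<phi> k" "N k \<le> \<phi> (Suc k)" for k
    using member_le_sum[of k "{..k}" N] by (auto simp: \<phi>_def)
  define d where "d k t = s (\<phi> (Suc k)) t - s (\<phi> k) t" for k t
  have [measurable]: "d k \<in> borel_measurable halfline" for k
    unfolding d_def by measurable
  have d_int: "integrable halfline (\<lambda>t. (norm (d k t))\<^sup>2)" for k
    unfolding d_def by (rule s_int)
  have d_small: "(\<integral>\<^sup>+t. ennreal (4 ^ k * (norm (d k t))\<^sup>2) \<partial>halfline) \<le> ennreal ((1 / 2) ^ k)" for k
  proof -
    have "(\<integral>\<^sup>+t. ennreal (4 ^ k * (norm (d k t))\<^sup>2) \<partial>halfline)
        = ennreal (4 ^ k * (LINT t|halfline. (norm (d k t))\<^sup>2))"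
      using d_int[of k] by (subst nn_integral_eq_integral) auto
    also have "\<dots> \<le> ennreal (4 ^ k * (1 / 8) ^ k)"
      using N[of k "\<phi> (Suc k)" "\<phi> k"] \<phi>_ge[of k] by (intro ennreal_leI mult_left_mono) (auto simp: d_def)
    also have "4 ^ k * (1 / 8) ^ k = (1 / 2 :: real) ^ k"
      by (simp flip: power_mult_distrib)
    finally show ?thesis .
  qed
  have "(\<integral>\<^sup>+t. (\<Sum>k. ennreal (4 ^ k * (norm (d k t))\<^sup>2)) \<partial>halfline)
      = (\<Sum>k. \<integral>\<^sup>+t. ennreal (4 ^ k * (norm (d k t))\<^sup>2) \<partial>halfline)"
    by (rule nn_integral_suminf) measurable
  also have "\<dots> \<le> (\<Sum>k. ennreal ((1 / 2) ^ k))"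
    by (intro suminf_le d_small) auto
  also have "\<dots> = ennreal (\<Sum>k. (1 / 2) ^ k)"
    by (intro suminf_ennreal2) (auto simp: summable_geometric)
  also have "\<dots> < \<infinity>"
    by simp
  finally have "AE t in halfline. (\<Sum>k. ennreal (4 ^ k * (norm (d k t))\<^sup>2)) \<noteq> \<infinity>"
    by (intro nn_integral_PInf_AE) auto
  then have AE_conv: "AE t in halfline. convergent (\<lambda>k. s (\<phi> k) t)"
  proof eventually_elim
    case (elim t)
    then have "summable (\<lambda>k. 4 ^ k * (norm (d k t))\<^sup>2)"
      by (intro summable_suminf_not_top) auto
    then have "\<forall>\<^sub>F k in sequentially. 4 ^ k * (norm (d k t))\<^sup>2 < 1"
      by (intro order_tendstoD(2)[OF summable_LIMSEQ_zero]) auto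
    then have "\<forall>\<^sub>F k in sequentially. norm (d k t) \<le> (1 / 2) ^ k"
    proof eventually_elim
      case (elim k)
      have "(2 ^ k * norm (d k t))\<^sup>2 = 4 ^ k * (norm (d k t))\<^sup>2"
        by (simp add: power_mult_distrib flip: power_mult) (simp add: power_mult mult.commute[of k])
      also have "\<dots> < 1\<^sup>2"
        using elim by simp
      finally have "2 ^ k * norm (d k t) < 1"
        by (rule power2_less_imp_less) simp
      then show ?case
        by (simp add: power_one_over field_simps)
    qed
    then have "summable (\<lambda>k. d k t)"
      by (rule summable_comparison_test_ev) (simp add: summable_geometric)
    then have "(\<lambda>k. s (\<phi> 0) t + (\<Sum>j<k. d j t)) \<longlonglongrightarrow> s (\<phi> 0) t + (\<Sum>j. d j t)"
      by (intro tendsto_intros summable_LIMSEQ)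
    moreover have "s (\<phi> 0) t + (\<Sum>j<k. d j t) = s (\<phi> k) t" for k
      unfolding d_def using sum_lessThan_telescope[of "\<lambda>j. s (\<phi> j) t" k] by simp
    ultimately show ?case
      by (auto simp: convergent_def)
  qed
  \<comment> \<open>Where the limit does not exist, \<open>lim\<close> takes some default value, on a null set only.\<close>
  define g where "g t = lim (\<lambda>k. s (\<phi> k) t)" for t
  have [measurable]: "g \<in> borel_measurable halfline"
    unfolding g_def by measurable
  have bound: "(\<integral>\<^sup>+t. ennreal ((norm (s n t - g t))\<^sup>2) \<partial>halfline) \<le> ennreal e"
    if n: "\<And>m. m \<ge> M \<Longrightarrow> (LINT t|halfline. (norm (s n t - s m t))\<^sup>2) \<le> e" for n M e
  proof -
    have "AE t in halfline. ennreal ((norm (s n t - g t))\<^sup>2)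
        = liminf (\<lambda>k. ennreal ((norm (s n t - s (\<phi> k) t))\<^sup>2))"
      using AE_conv
    proof eventually_elim
      case (elim t)
      then have "(\<lambda>k. s (\<phi> k) t) \<longlonglongrightarrow> g t"
        by (simp add: g_def convergent_LIMSEQ_iff)
      then have "(\<lambda>k. ennreal ((norm (s n t - s (\<phi> k) t))\<^sup>2)) \<longlonglongrightarrow> ennreal ((norm (s n t - g t))\<^sup>2)"
        by (intro tendsto_intros tendsto_ennrealI)
      then show ?case
        by (intro lim_imp_Liminf[symmetric]) auto
    qed
    then have "(\<integral>\<^sup>+t. ennreal ((norm (s n t - g t))\<^sup>2) \<partial>halfline)
        = (\<integral>\<^sup>+t. liminf (\<lambda>k. ennreal ((norm (s n t - s (\<phi> k) t))\<^sup>2)) \<partial>halfline)"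
      by (rule nn_integral_cong_AE)
    also have "\<dots> \<le> liminf (\<lambda>k. \<integral>\<^sup>+t. ennreal ((norm (s n t - s (\<phi> k) t))\<^sup>2) \<partial>halfline)"
      by (rule nn_integral_liminf) measurable
    also have "\<dots> \<le> ennreal e"
    proof (rule Liminf_le)
      show "\<forall>\<^sub>F k in sequentially. (\<integral>\<^sup>+t. ennreal ((norm (s n t - s (\<phi> k) t))\<^sup>2) \<partial>halfline) \<le> ennreal e"
        using eventually_ge_at_top[of M]
      proof eventually_elim
        case (elim k)
        then show ?case
          using n[of "\<phi> k"] \<phi>_ge(1)[of k] s_int[of n "\<phi> k"]
          by (subst nn_integral_eq_integral) (auto intro: ennreal_leI)
      qed
    qed simp
    finally show ?thesis .
  qed
  have diff_int: "integrable halfline (\<lambda>t. (norm (s n t - g t))\<^sup>2)"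
    and diff_le: "(LINT t|halfline. (norm (s n t - g t))\<^sup>2) \<le> e"
    if n: "\<And>m. m \<ge> M \<Longrightarrow> (LINT t|halfline. (norm (s n t - s m t))\<^sup>2) \<le> e" for n M e
  proof -
    have "e \<ge> 0"
      by (rule order_trans[OF _ n[OF order_refl]]) simp
    show int: "integrable halfline (\<lambda>t. (norm (s n t - g t))\<^sup>2)"
      using le_less_trans[OF bound[OF n]] by (intro integrableI_nonneg) auto
    show "(LINT t|halfline. (norm (s n t - g t))\<^sup>2) \<le> e"
      using bound[OF n] int \<open>e \<ge> 0\<close> by (subst (asm) nn_integral_eq_integral) (auto simp: ennreal_le_iff)
  qed
  have g: "square_integrable g"
  proof -
    have "integrable halfline (\<lambda>t. (norm (s (N 0) t - g t))\<^sup>2)"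
      using N[of 0 "N 0"] by (intro diff_int[of "N 0" "N 0" 1]) (auto intro: less_imp_le)
    then have "square_integrable (\<lambda>t. s (N 0) t - g t)"
      by (simp add: square_integrable_def)
    from square_integrable_diff[OF s[of "N 0"] this] show ?thesis
      by simp
  qed
  have "(\<lambda>n. LINT t|halfline. (norm (s n t - g t))\<^sup>2) \<longlonglongrightarrow> 0"
  proof (rule LIMSEQ_I)
    fix e :: real assume "e > 0"
    then obtain M where M: "\<And>m n. m \<ge> M \<Longrightarrow> n \<ge> M \<Longrightarrow> (LINT t|halfline. (norm (s m t - s n t))\<^sup>2) < e / 2"
      using Cauchy[of "e / 2"] by auto
    have "norm ((LINT t|halfline. (norm (s n t - g t))\<^sup>2) - 0) < e" if "n \<ge> M" for n
    proof -
      have "(LINT t|halfline. (norm (s n t - g t))\<^sup>2) \<le> e / 2"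
        using M that by (intro diff_le[of M n "e / 2"]) (auto intro: less_imp_le)
      moreover have "(LINT t|halfline. (norm (s n t - g t))\<^sup>2) \<ge> 0"
        by simp
      ultimately show ?thesis
        using \<open>e > 0\<close> by simp
    qed
    then show "\<exists>M. \<forall>n\<ge>M. norm ((LINT t|halfline. (norm (s n t - g t))\<^sup>2) - 0) < e"
      by blast
  qed
  with g show ?thesis by (rule that)
qed

lemma laplace_integral_tendsto:
  assumes s: "\<And>n. square_integrable (s n)" and g: "square_integrable g"
    and lim: "(\<lambda>n. LINT t|halfline. (norm (s n t - g t))\<^sup>2) \<longlonglongrightarrow> 0" and x: "x > 0"
  shows "(\<lambda>n. laplace_integral (s n) x) \<longlonglongrightarrow> laplace_integral g x"
proof -
  define C where "C = (LINT t|halfline. (norm (complex_of_real (exp (- t * x))))\<^sup>2)"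
  have "(norm (laplace_integral (s n) x - laplace_integral g x))\<^sup>2
      \<le> C * (LINT t|halfline. (norm (s n t - g t))\<^sup>2)" (is "?lhs n \<le> ?rhs n") for n
  proof -
    have "laplace_integral (s n) x - laplace_integral g x = laplace_integral (\<lambda>t. s n t - g t) x"
      using laplace_integral_diff[OF s g x] by simp
    then show ?thesis
      unfolding C_def laplace_integral_def[of "\<lambda>t. s n t - g t"]
      using square_integrable_Cauchy_Schwarz[OF square_integrable_exp[OF x] square_integrable_diff[OF s[of n] g]]
      by simp
  qed
  then have "\<forall>\<^sub>F n in sequentially. norm (?lhs n) \<le> ?rhs n"
    by (intro always_eventually allI) simp
  moreover have "?rhs \<longlonglongrightarrow> 0"
    using tendsto_mult_right_zero[OF lim] .
  ultimately have "?lhs \<longlonglongrightarrow> 0"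
    by (rule Lim_null_comparison)
  then have "(\<lambda>n. sqrt ((norm (laplace_integral (s n) x - laplace_integral g x))\<^sup>2)) \<longlonglongrightarrow> sqrt 0"
    by (rule tendsto_real_sqrt)
  then have "(\<lambda>n. norm (laplace_integral (s n) x - laplace_integral g x)) \<longlonglongrightarrow> 0"
    by simp
  then show ?thesis
    by (subst tendsto_dist_iff) (simp only: dist_norm)
qed

text \<open>
  Take the residuals \<open>r\<^sub>n\<close> of \<open>exp(-b t)\<close> for finite sets \<open>F\<^sub>n\<close> increasing to \<open>A\<close>. By
  \<open>exp_residual_norm_diff\<close> their squared distances are the differences of \<open>P\<^sub>n / (2 b)\<close>, where \<open>P\<^sub>n\<close> is the square at \<open>b\<close> of the
  Blaschke product of \<open>F\<^sub>n\<close>. The \<open>P\<^sub>n\<close> decrease to a positive limit, so \<open>r\<^sub>n\<close> converges; each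
  point of \<open>A\<close> is eventually a zero of the transform of \<open>r\<^sub>n\<close>, while the value at \<open>b\<close> is \<open>P\<^sub>n / (2 b)\<close>.
\<close>

lemma laplace_integral_interpolation:
  assumes A: "A \<subseteq> {0<..}" "(\<lambda>a. a / (a\<^sup>2 + 1)) summable_on A" and b: "b > 0" "b \<notin> A"
  shows "\<exists>g. square_integrable g \<and> (\<forall>a\<in>A. laplace_integral g a = 0) \<and> laplace_integral g b \<noteq> 0"
proof -
  have "countable A"
    using A by (rule countable_if_summable)
  define F where "F n = {a \<in> A. to_nat_on A a < n}" for n
  have F1: "finite (F n)" for n
  proof (rule finite_imageD)
    show "finite (to_nat_on A ` F n)"
      by (rule finite_subset[of _ "{..<n}"]) (auto simp: F_def)
    show "inj_on (to_nat_on A) (F n)"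
      using inj_on_to_nat_on[OF \<open>countable A\<close>] by (rule inj_on_subset) (auto simp: F_def)
  qed
  have FA: "F n \<subseteq> A" and mono: "m \<le> n \<Longrightarrow> F m \<subseteq> F n" for m n
    by (auto simp: F_def)
  have F: "finite (F n)" "F n \<subseteq> {0<..}" "b \<notin> F n" for n
    using F1[of n] order_trans[OF FA A(1)] FA[of n] b(2) by auto
  define P where "P n = (blaschke (F n) b)\<^sup>2" for n
  from blaschke_bounded_below[OF A b] obtain \<delta> where "\<delta> > 0"
    and \<delta>': "\<forall>F. finite F \<longrightarrow> F \<subseteq> A \<longrightarrow> \<delta> \<le> (blaschke F b)\<^sup>2"
    by (elim exE conjE)
  have "\<delta> \<le> P n" for n
    unfolding P_def using \<delta>'[rule_format, OF F1 FA] .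
  note \<delta> = \<open>\<delta> > 0\<close> this
  have "\<exists>r. \<forall>n. exp_residual (F n) b (r n)"
    by (intro choice allI exp_residual_exists F b)
  then obtain r where r: "\<And>n. exp_residual (F n) b (r n)"
    by blast
  have sq: "square_integrable (r n)" for n
    by (rule square_integrable_exp_residual[OF F(1,2) b(1) F(3) r])
  have diff: "(LINT t|halfline. (norm (r m t - r n t))\<^sup>2) = (P m - P n) / (2 * b)" if "m \<le> n" for m n
    unfolding P_def by (rule exp_residual_norm_diff[OF F(1) mono[OF that] F(2) b(1) F(3) r r])
  have P_mono: "P n \<le> P m" if "m \<le> n" for m n
  proof -
    have "(P m - P n) / (2 * b) \<ge> 0"
      unfolding diff[OF that, symmetric] by simp
    then show ?thesis using b(1) by (simp add: zero_le_divide_iff)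
  qed
  have diff': "(LINT t|halfline. (norm (r m t - r n t))\<^sup>2) = \<bar>P m - P n\<bar> / (2 * b)" for m n
  proof (cases "m \<le> n")
    case True
    then show ?thesis
      using diff[OF True] P_mono[OF True] by simp
  next
    case False
    then have "n \<le> m" by simp
    have "(LINT t|halfline. (norm (r m t - r n t))\<^sup>2) = (LINT t|halfline. (norm (r n t - r m t))\<^sup>2)"
      by (subst norm_minus_commute) (rule refl)
    then show ?thesis
      using diff[OF \<open>n \<le> m\<close>] P_mono[OF \<open>n \<le> m\<close>] by simp
  qed
  have "decseq P"
    unfolding decseq_def using P_mono by blast
  then obtain p where p: "P \<longlonglongrightarrow> p"
    using decseq_convergent[OF \<open>decseq P\<close> allI[OF \<delta>(2)]] by metis
  then have "Cauchy P"
    by (rule LIMSEQ_imp_Cauchy)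
  have "\<exists>N. \<forall>m\<ge>N. \<forall>n\<ge>N. (LINT t|halfline. (norm (r m t - r n t))\<^sup>2) < e" if "e > 0" for e
  proof -
    obtain N where "\<forall>m\<ge>N. \<forall>n\<ge>N. \<bar>P m - P n\<bar> < e * (2 * b)"
      using CauchyD[OF \<open>Cauchy P\<close>, of "e * (2 * b)"] \<open>e > 0\<close> b(1) by auto
    then show ?thesis
      using b(1) by (intro exI[of _ N]) (simp only: diff' pos_divide_less_eq mult_pos_pos zero_less_numeral)
  qed
  then obtain g where g: "square_integrable g" "(\<lambda>n. LINT t|halfline. (norm (r n t - g t))\<^sup>2) \<longlonglongrightarrow> 0"
    by (rule square_integrable_complete[OF sq])
  note lim = laplace_integral_tendsto[OF sq g]
  note lr = laplace_integral_exp_residual[OF F(1,2) b(1) F(3) r]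
  show ?thesis
  proof (intro exI[of _ g] conjI ballI g(1))
    fix a assume a: "a \<in> A"
    then have "a > 0" using A by auto
    have "\<forall>\<^sub>F n in sequentially. laplace_integral (r n) a = 0"
      using eventually_gt_at_top[of "to_nat_on A a"]
    proof eventually_elim
      case (elim n)
      then have "a \<in> F n" using a by (simp add: F_def)
      then show ?case
        using lr[OF \<open>a > 0\<close>, of n] F(1)[of n] by (simp add: blaschke_zero)
    qed
    then have "(\<lambda>n. laplace_integral (r n) a) \<longlonglongrightarrow> 0"
      by (rule tendsto_eventually)
    then show "laplace_integral g a = 0"
      using lim[OF \<open>a > 0\<close>] LIMSEQ_unique by blast
  next
    have "(\<lambda>n. laplace_integral (r n) b) = (\<lambda>n. of_real (P n / (2 * b)))"
      by (rule ext) (simp add: lr[OF b(1)] P_def power2_eq_square)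
    then have "(\<lambda>n. complex_of_real (P n / (2 * b))) \<longlonglongrightarrow> laplace_integral g b"
      using lim[OF b(1)] by simp
    moreover have "(\<lambda>n. complex_of_real (P n / (2 * b))) \<longlonglongrightarrow> of_real (p / (2 * b))"
      using p b by (intro tendsto_intros) auto
    ultimately have "laplace_integral g b = of_real (p / (2 * b))"
      by (rule LIMSEQ_unique)
    moreover have "p \<ge> \<delta>"
      by (rule LIMSEQ_le_const[OF p]) (simp add: \<delta>(2))
    ultimately show "laplace_integral g b \<noteq> 0"
      using \<open>\<delta> > 0\<close> b(1) by simp
  qed
qed

section \<open>Injectivity of the Laplace transform\<close>

text \<open>
  The Borel sets over which \<open>h\<close> has integral zero form a Dynkin system, and the half-lines are an
  intersection-stable generator of the Borel sets.
\<close>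

lemma AE_zero_if_tail_integrals_zero:
  fixes h :: "real \<Rightarrow> 'a::{banach, second_countable_topology}"
  assumes h: "integrable lborel h" and total: "(LINT t|lborel. h t) = 0"
    and tail: "\<And>x. (LINT t:{x<..}|lborel. h t) = 0"
  shows "AE t in lborel. h t = 0"
proof (rule sigma_finite_measure.density_zero[OF sigma_finite_lborel h])
  fix A :: "real set" assume "A \<in> sets lborel"
  have sets_eq: "sigma_sets UNIV (range greaterThan) = sets (borel :: real measure)"
    by (subst borel_Ioi) simp
  have "Int_stable (range (greaterThan :: real \<Rightarrow> real set))"
  proof (rule Int_stableI_image)
    fix a b :: real
    have "{a<..} \<inter> {b<..} = {max a b<..}" by auto
    then show "\<exists>c\<in>UNIV. {a<..} \<inter> {b<..} = {c<..}" by blast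
  qed
  moreover have "range (greaterThan :: real \<Rightarrow> real set) \<subseteq> Pow UNIV"
    by simp
  moreover have "A \<in> sigma_sets UNIV (range greaterThan)"
    using \<open>A \<in> sets lborel\<close> by (simp add: sets_eq)
  ultimately show "(LINT t:A|lborel. h t) = 0"
  proof (induction rule: sigma_sets_induct_disjoint)
    case (basic A)
    then show ?case using tail by auto
  next
    case empty
    show ?case by (simp add: set_lebesgue_integral_def)
  next
    case (compl A)
    then have A: "A \<in> sets lborel" by (simp add: sets_eq)
    have "(LINT t|lborel. h t) = (LINT t:A \<union> (UNIV - A)|lborel. h t)"
      by (simp add: set_lebesgue_integral_def)
    also have "\<dots> = (LINT t:A|lborel. h t) + (LINT t:UNIV - A|lborel. h t)"
      using A h by (intro set_integral_Un) (auto simp: set_integrable_def intro!: integrable_mult_indicator)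
    finally show ?case using compl total by simp
  next
    case (union A)
    then have A: "\<And>i. A i \<in> sets lborel" by (auto simp: sets_eq)
    have "(LINT t:(\<Union>i. A i)|lborel. h t) = (\<Sum>i. LINT t:A i|lborel. h t)"
    proof (rule lebesgue_integral_countable_add)
      show "A i \<inter> A j = {}" if "i \<noteq> j" for i j
        using union(1) that by (auto simp: disjoint_family_on_def)
      show "set_integrable lborel (\<Union>i. A i) h"
        unfolding set_integrable_def using A by (intro integrable_mult_indicator h) auto
    qed (rule A)
    then show ?case using union by simp
  qed
qed

text \<open>
  The hypothesis says that \<open>g(t) = exp(-t) f(t)\<close>, which is integrable, is annihilated by all powers
  of \<open>exp(-t)\<close>. By the Weierstrass theorem \<open>g\<close> is annihilated by all \<open>p(exp(-t))\<close> with \<open>p\<close> continuous,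
  and by dominated convergence by the indicators of half-lines.
\<close>

lemma laplace_integral_eq_0_imp_AE_0:
  assumes f: "square_integrable f" and zero: "\<And>n::nat. laplace_integral f (real (Suc n)) = 0"
  shows "AE t in halfline. f t = 0"
proof -
  define g where "g t = of_real (exp (- t)) * f t" for t
  have [measurable]: "f \<in> borel_measurable halfline"
    using f by (auto simp: square_integrable_def)
  have g: "integrable halfline g"
    using laplace_integrable[OF f, of 1] by (simp add: g_def[abs_def])
  then have [measurable]: "g \<in> borel_measurable halfline"
    by simp
  have half: "exp (- t) \<in> {0..1}" if "t \<in> space halfline" for t :: real
    using that by (simp add: space_restrict_space)
  have meas: "(\<lambda>t. p (exp (- t))) \<in> borel_measurable halfline"
    if "continuous_on UNIV p" for p :: "real \<Rightarrow> real"
  proof -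
    have [measurable]: "p \<in> borel_measurable borel"
      using that by (rule borel_measurable_continuous_onI)
    show ?thesis
      by (rule measurable_restrict_space1) measurable
  qed
  have int: "integrable halfline (\<lambda>t. of_real (p (exp (- t))) * g t)"
    if p: "continuous_on UNIV p" for p :: "real \<Rightarrow> real"
  proof -
    have "compact (p ` {0..1})"
      using p by (intro compact_continuous_image) (auto intro: continuous_on_subset)
    then obtain B where B: "\<And>u. u \<in> {0..1} \<Longrightarrow> \<bar>p u\<bar> \<le> B"
      by (meson bounded_real compact_imp_bounded imageI)
    show ?thesis
    proof (rule Bochner_Integration.integrable_bound)
      show "integrable halfline (\<lambda>t. B * norm (g t))"
        using g by simp
      show "(\<lambda>t. of_real (p (exp (- t))) * g t) \<in> borel_measurable halfline"
        using meas[OF p] by measurable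
      show "AE t in halfline. norm (of_real (p (exp (- t))) * g t) \<le> norm (B * norm (g t))"
      proof (rule AE_I2)
        fix t assume "t \<in> space halfline"
        then have "\<bar>p (exp (- t))\<bar> \<le> B" by (intro B half)
        then show "norm (of_real (p (exp (- t))) * g t) \<le> norm (B * norm (g t))"
          by (auto simp: norm_mult abs_mult intro!: mult_right_mono)
      qed
    qed
  qed
  have mono0: "(LINT t|halfline. of_real (exp (- t) ^ n) * g t) = 0" for n
  proof -
    have "of_real (exp (- t) ^ n) * g t = of_real (exp (- t * real (Suc n))) * f t" for t
      unfolding g_def mult.assoc[symmetric] of_real_mult[symmetric]
      by (simp add: exp_of_nat_mult[symmetric] exp_add[symmetric] algebra_simps)
    then show ?thesis
      using zero[of n] by (simp add: laplace_integral_def)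
  qed
  have poly0: "(LINT t|halfline. of_real (p (exp (- t))) * g t) = 0"
    if "real_polynomial_function p" for p :: "real \<Rightarrow> real"
  proof -
    obtain a n where p: "p = (\<lambda>x. \<Sum>i\<le>n. a i * x ^ i)"
      using \<open>real_polynomial_function p\<close> unfolding real_polynomial_function_iff_sum by blast
    have "(LINT t|halfline. of_real (p (exp (- t))) * g t)
        = (LINT t|halfline. (\<Sum>i\<le>n. of_real (a i) * (of_real (exp (- t) ^ i) * g t)))"
      by (simp add: p sum_distrib_right mult.assoc)
    also have "\<dots> = (\<Sum>i\<le>n. LINT t|halfline. of_real (a i) * (of_real (exp (- t) ^ i) * g t))"
      by (intro Bochner_Integration.integral_sum integrable_mult_right int continuous_intros)
    also have "\<dots> = 0"
      by (simp only: integral_mult_right_zero mono0 mult_zero_right sum.neutral_const)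
    finally show ?thesis .
  qed
  have cont0: "(LINT t|halfline. of_real (p (exp (- t))) * g t) = 0"
    if p: "continuous_on UNIV p" for p :: "real \<Rightarrow> real"
  proof -
    define I where "I = (LINT t|halfline. norm (g t))"
    have "norm (LINT t|halfline. of_real (p (exp (- t))) * g t) \<le> e * I" if "e > 0" for e
    proof -
      obtain q where q: "real_polynomial_function q" "\<And>u. u \<in> {0..1} \<Longrightarrow> \<bar>p u - q u\<bar> < e"
        using Stone_Weierstrass_real_polynomial_function[of "{0..1}" p e] p \<open>e > 0\<close>
        by (metis compact_Icc continuous_on_subset subset_UNIV)
      have q_cont: "continuous_on UNIV q"
        using q(1) continuous_on_polymonial_function real_polynomial_function_eq by blast
      have "(LINT t|halfline. of_real (p (exp (- t))) * g t)
          = (LINT t|halfline. of_real (p (exp (- t))) * g t - of_real (q (exp (- t))) * g t)"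
        by (simp add: Bochner_Integration.integral_diff[OF int[OF p] int[OF q_cont]] poly0[OF q(1)])
      also have "norm \<dots> \<le> (LINT t|halfline. e * norm (g t))"
      proof (rule Bochner_Integration.integral_norm_bound_integral)
        fix t assume "t \<in> space halfline"
        have "norm (of_real (p (exp (- t))) * g t - of_real (q (exp (- t))) * g t)
            = \<bar>p (exp (- t)) - q (exp (- t))\<bar> * norm (g t)"
          by (simp only: left_diff_distrib[symmetric] of_real_diff[symmetric] norm_mult norm_of_real)
        also have "\<dots> \<le> e * norm (g t)"
          using q(2)[OF half[OF \<open>t \<in> space halfline\<close>]] by (intro mult_right_mono) auto
        finally show "norm (of_real (p (exp (- t))) * g t - of_real (q (exp (- t))) * g t) \<le> e * norm (g t)" .
      qed (use g int[OF p] int[OF q_cont] in \<open>auto intro!: Bochner_Integration.integrable_diff\<close>)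
      also have "\<dots> = e * I"
        by (simp add: I_def)
      finally show ?thesis .
    qed
    moreover have "((\<lambda>e. e * I) \<longlongrightarrow> 0 * I) (at_right 0)"
      by (intro tendsto_intros)
    ultimately have "norm (LINT t|halfline. of_real (p (exp (- t))) * g t) \<le> 0 * I"
      by (intro tendsto_lowerbound[where F = "at_right 0" and f = "\<lambda>e. e * I"])
        (auto simp: eventually_at_right_less intro: eventually_mono[OF eventually_at_right_less])
    then show ?thesis by simp
  qed
  have ind0: "(LINT t|halfline. indicator {s<..} t *\<^sub>R g t) = 0" for s
  proof -
    \<comment> \<open>As \<open>n\<close> grows, \<open>p n\<close> tends to the indicator of \<open>u < exp (- s)\<close>, that is, of \<open>t > s\<close> when \<open>u = exp (- t)\<close>.\<close>
    define p where "p n u = max 0 (min 1 (real n * (exp (- s) - u)))" for n u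
    have p_cont: "continuous_on UNIV (p n)" for n
      unfolding p_def by (intro continuous_intros)
    have "(\<lambda>n. LINT t|halfline. of_real (p n (exp (- t))) * g t) \<longlonglongrightarrow>
        (LINT t|halfline. indicator {s<..} t *\<^sub>R g t)"
    proof (rule integral_dominated_convergence)
      show "(\<lambda>t. indicat_real {s<..} t *\<^sub>R g t) \<in> borel_measurable halfline"
      proof -
        have [measurable]: "indicat_real {s<..} \<in> borel_measurable halfline"
          by (rule measurable_restrict_space1) measurable
        show ?thesis by measurable
      qed
      show "(\<lambda>t. of_real (p n (exp (- t))) * g t) \<in> borel_measurable halfline" for n
        using int[OF p_cont[of n]] by simp
      show "integrable halfline (\<lambda>t. norm (g t))"
        using g by simp
      show "AE t in halfline. norm (of_real (p n (exp (- t))) * g t) \<le> norm (g t)" for n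
        by (intro AE_I2) (auto simp: norm_mult p_def intro!: mult_left_le_one_le)
      have "(\<lambda>n. p n (exp (- t))) \<longlonglongrightarrow> indicator {s<..} t" for t
      proof (cases "s < t")
        case True
        then have pos: "exp (- s) - exp (- t) > 0" by simp
        then have "\<forall>\<^sub>F n in sequentially. real n * (exp (- s) - exp (- t)) \<ge> 1"
          using eventually_ge_at_top[of "nat \<lceil>1 / (exp (- s) - exp (- t))\<rceil>"]
        proof (elim eventually_mono)
          fix n assume "nat \<lceil>1 / (exp (- s) - exp (- t))\<rceil> \<le> n"
          then have "1 / (exp (- s) - exp (- t)) \<le> real n" by linarith
          then show "real n * (exp (- s) - exp (- t)) \<ge> 1"
            using pos by (simp add: divide_le_eq)
        qed
        then have "\<forall>\<^sub>F n in sequentially. p n (exp (- t)) = 1"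
          by eventually_elim (simp add: p_def)
        then show ?thesis
          using True by (simp add: tendsto_eventually)
      next
        case False
        then have "exp (- s) - exp (- t) \<le> 0" by simp
        then have "p n (exp (- t)) = 0" for n
          by (simp add: p_def mult_nonneg_nonpos min.coboundedI2)
        then show ?thesis
          using False by simp
      qed
      then show "AE t in halfline. (\<lambda>n. of_real (p n (exp (- t))) * g t) \<longlonglongrightarrow> indicator {s<..} t *\<^sub>R g t"
        unfolding scaleR_conv_of_real by (intro AE_I2 tendsto_intros)
    qed
    then show ?thesis
      by (simp add: cont0[OF p_cont] LIMSEQ_const_iff)
  qed
  define h where "h t = indicator {0<..} t *\<^sub>R g t" for t
  have "AE t in lborel. h t = 0"
  proof (rule AE_zero_if_tail_integrals_zero)
    show "integrable lborel h"
      using g by (simp add: integrable_restrict_space h_def[abs_def])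
    show "(LINT t|lborel. h t) = 0"
      using mono0[of 0] by (simp add: integral_restrict_space h_def)
    show "(LINT t:{x<..}|lborel. h t) = 0" for x
      using ind0[of x] by (simp add: integral_restrict_space h_def set_lebesgue_integral_def mult.commute)
  qed
  then have "AE t in halfline. g t = 0"
    by (simp add: AE_restrict_space_iff h_def indicator_def)
  then show ?thesis
    by (simp add: g_def)
qed

section \<open>The Laplace transform on classes\<close>

lemma l2_rel_rep: "l2_rel (rep_l2 u) (rep_l2 u)"
  using Quotient3_rep_reflp[OF Quotient3_l2] .

lemma square_integrable_rep: "square_integrable (rep_l2 u)"
  using l2_rel_rep by (auto simp: l2_rel_def)

lemma laplace_rep: "laplace u x = laplace_integral (rep_l2 u) x"
  by (simp add: laplace.rep_eq laplace_integral_def)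

lemma laplace_abs:
  assumes "square_integrable f"
  shows "laplace (abs_l2 f) x = laplace_integral f x"
  using assms by (subst laplace.abs_eq) (auto simp: l2_rel_def laplace_integral_def eq_onp_def)

lemma laplace_zero: "laplace 0 x = 0"
  by transfer simp

lemma laplace_add:
  assumes "x > 0"
  shows "laplace (u + v) x = laplace u x + laplace v x"
  using assms
proof transfer
  fix x :: real and f g :: "real \<Rightarrow> complex"
  assume "x > 0" "l2_rel f f" "l2_rel g g"
  then show "(LINT t|halfline. of_real (exp (- t * x)) * (f t + g t))
      = (LINT t|halfline. of_real (exp (- t * x)) * f t) + (LINT t|halfline. of_real (exp (- t * x)) * g t)"
    unfolding distrib_left by (intro Bochner_Integration.integral_add laplace_integrable) (auto simp: l2_rel_def)
qed

lemma laplace_scale: "laplace (l2_scale c u) x = c * laplace u x"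
  by transfer (simp add: mult.left_commute)

lemma laplace_sum:
  assumes "x > 0"
  shows "laplace (\<Sum>v\<in>S. l2_scale (c v) v) x = (\<Sum>v\<in>S. c v * laplace v x)"
  by (induction S rule: infinite_finite_induct) (simp_all add: assms laplace_zero laplace_add laplace_scale)

lemma laplace_inject:
  assumes "\<And>x. x > 0 \<Longrightarrow> laplace u x = 0"
  shows "u = 0"
proof -
  have "AE t in halfline. rep_l2 u t = 0"
    using assms by (intro laplace_integral_eq_0_imp_AE_0 square_integrable_rep) (simp flip: laplace_rep)
  then have "l2_rel (rep_l2 u) (\<lambda>t. 0)"
    using square_integrable_rep square_integrable_zero by (simp add: l2_rel_def)
  then have "abs_l2 (rep_l2 u) = abs_l2 (\<lambda>t. 0)"
    by (intro Quotient3_rel_abs[OF Quotient3_l2])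
  then show ?thesis
    by (simp add: Quotient3_abs_rep[OF Quotient3_l2] zero_l2_def)
qed

lemma laplace_measurable: "laplace u \<in> borel_measurable borel"
proof -
  interpret sigma_finite_measure halfline
    by (rule sigma_finite_measure_restrict_space) (auto intro: lborel.sigma_finite_measure_axioms)
  have [measurable]: "rep_l2 u \<in> borel_measurable halfline"
    using square_integrable_rep by (auto simp: square_integrable_def)
  have "(\<lambda>t. t) \<in> measurable halfline borel"
    by (rule measurable_restrict_space1) simp
  then have [measurable]: "(\<lambda>p. snd p) \<in> measurable (borel \<Otimes>\<^sub>M halfline) borel"
    by (rule measurable_compose[OF measurable_snd])
  have "(\<lambda>x. LINT t|halfline. of_real (exp (- t * x)) * rep_l2 u t) \<in> borel_measurable borel"
    by (rule borel_measurable_lebesgue_integral) (unfold split_beta', measurable)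
  then show ?thesis
    by (simp add: laplace.rep_eq[abs_def])
qed

section \<open>The kernel of the Hankel operator\<close>

definition laplace_kernel :: "real measure \<Rightarrow> l2 set" where
  "laplace_kernel \<mu> = {u. AE x in \<mu>. x > 0 \<longrightarrow> laplace u x = 0}"

text \<open>
  If \<open>u\<close> is in the kernel of the operator, the form at \<open>(u, u)\<close> is \<open>\<integral> |\<L>u|\<^sup>2 d\<mu> = 0\<close>. If \<open>\<L>u\<close> vanishes
  almost everywhere, then \<open>u\<close> belongs to the form domain and pairs to zero with everything.
\<close>

lemma operator_kernel_hankel_operator:
  assumes \<mu>: "sets \<mu> = sets borel"
  shows "operator_kernel (hankel_operator \<mu>) = laplace_kernel \<mu>"
proof (intro set_eqI iffI)
  fix u
  have inner0: "l2_inner 0 h = 0" for h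
    by transfer simp
  have [measurable_cong]: "sets \<mu> = sets borel" by (rule \<mu>)
  have [measurable]: "laplace v \<in> borel_measurable \<mu>" for v
    using laplace_measurable by (simp add: measurable_cong_sets[OF \<mu> refl])
  {
    assume "u \<in> operator_kernel (hankel_operator \<mu>)"
    then have dom: "u \<in> hankel_form_domain \<mu>" and form: "hankel_form \<mu> u u = 0"
      by (simp_all add: operator_kernel_def hankel_operator_def form_operator_def inner0)
    define q where "q x = indicator {0<..} x * (norm (laplace u x))\<^sup>2" for x
    have q_meas: "q \<in> borel_measurable \<mu>"
      unfolding q_def by measurable
    have "(\<integral>\<^sup>+x. ennreal (q x) \<partial>\<mu>) = (\<integral>\<^sup>+x\<in>{0<..}. ennreal ((norm (laplace u x))\<^sup>2) \<partial>\<mu>)"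
      by (intro nn_integral_cong) (simp add: q_def indicator_def)
    also have "\<dots> < \<infinity>"
      using dom by (simp add: hankel_form_domain_def)
    finally have q: "integrable \<mu> q"
      using q_meas by (intro integrableI_nonneg) (simp_all add: q_def)
    have "complex_of_real (q x) = indicat_real {0<..} x *\<^sub>R (laplace u x * cnj (laplace u x))" for x
      unfolding q_def of_real_mult complex_norm_square scaleR_conv_of_real ..
    then have "hankel_form \<mu> u u = (LINT x|\<mu>. complex_of_real (q x))"
      by (simp only: hankel_form_def set_lebesgue_integral_def)
    then have "(LINT x|\<mu>. q x) = 0"
      unfolding form integral_complex_of_real by simp
    then have "AE x in \<mu>. q x = 0"
      by (subst (asm) integral_nonneg_eq_0_iff_AE[OF q]) (simp_all add: q_def)
    then have "AE x in \<mu>. x > 0 \<longrightarrow> laplace u x = 0"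
      by eventually_elim (auto simp: q_def)
    then show "u \<in> laplace_kernel \<mu>"
      by (simp add: laplace_kernel_def)
  next
    assume "u \<in> laplace_kernel \<mu>"
    then have ae: "AE x in \<mu>. x > 0 \<longrightarrow> laplace u x = 0"
      by (simp add: laplace_kernel_def)
    have "AE x in \<mu>. ennreal ((norm (laplace u x))\<^sup>2) * indicator {0<..} x = 0"
      using ae by eventually_elim (auto simp: indicator_def)
    then have "(\<integral>\<^sup>+x\<in>{0<..}. ennreal ((norm (laplace u x))\<^sup>2) \<partial>\<mu>) = (\<integral>\<^sup>+x. 0 \<partial>\<mu>)"
      by (rule nn_integral_cong_AE)
    moreover have "hankel_form \<mu> u h = 0" for h
    proof -
      have "AE x in \<mu>. indicat_real {0<..} x *\<^sub>R (laplace u x * cnj (laplace h x)) = 0"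
        using ae by eventually_elim (auto simp: indicator_def)
      then show ?thesis
        unfolding hankel_form_def set_lebesgue_integral_def by (rule integral_eq_zero_AE)
    qed
    ultimately show "u \<in> operator_kernel (hankel_operator \<mu>)"
      by (simp add: operator_kernel_def hankel_operator_def form_operator_def hankel_form_domain_def inner0)
  }
qed

text \<open>
  If \<open>V\<close> lies in the span of \<open>n\<close> vectors, choose \<open>n + 1\<close> points \<open>C\<close> outside \<open>A\<close>. Interpolation on
  \<open>A\<close> together with all but one point of \<open>C\<close> yields elements of \<open>V\<close> that are, up to non-zero factors,
  dual to the evaluations at the points of \<open>C\<close>, hence \<open>n + 1\<close> independent vectors in \<open>V\<close>,
  which is impossible.
\<close>

lemma infinite_dimensional_if_zeros:
  assumes A: "A \<subseteq> {0<..}" "(\<lambda>a. a / (a\<^sup>2 + 1)) summable_on A"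
    and V: "\<And>u. (\<And>a. a \<in> A \<Longrightarrow> laplace u a = 0) \<Longrightarrow> u \<in> V"
  shows "infinite_dimensional V"
  unfolding infinite_dimensional_def
proof
  assume "\<exists>B. finite B \<and> V \<subseteq> l2.span B"
  then obtain B where B: "finite B" "V \<subseteq> l2.span B" by blast
  have "countable A"
    using A by (rule countable_if_summable)
  have "infinite ({0<..} - A)"
  proof
    assume "finite ({0<..} - A)"
    from countable_Un[OF countable_finite[OF this] \<open>countable A\<close>] have "countable {0::real<..<1}"
      by (rule countable_subset[rotated]) auto
    then show False
      using uncountable_open_interval[of 0 "1::real"] by simp
  qed
  then obtain C where C: "finite C" "card C = Suc (card B)" "C \<subseteq> {0<..} - A"
    by (meson infinite_arbitrarily_large)
  have "\<exists>u. (\<forall>a\<in>A \<union> (C - {c}). laplace u a = 0) \<and> laplace u c \<noteq> 0" if "c \<in> C" for c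
  proof -
    have "(\<lambda>a. a / (a\<^sup>2 + 1)) summable_on (A \<union> (C - {c}))"
      using A(2) C(1) by (intro summable_on_union) auto
    moreover have "A \<union> (C - {c}) \<subseteq> {0<..}" "c > 0" "c \<notin> A \<union> (C - {c})"
      using A(1) C(3) that by auto
    ultimately obtain g where "square_integrable g" "\<forall>a\<in>A \<union> (C - {c}). laplace_integral g a = 0"
      "laplace_integral g c \<noteq> 0"
      using laplace_integral_interpolation[of "A \<union> (C - {c})" c] by auto
    then show ?thesis
      by (intro exI[of _ "abs_l2 g"]) (simp add: laplace_abs)
  qed
  then have "\<exists>u. \<forall>c\<in>C. (\<forall>a\<in>A \<union> (C - {c}). laplace (u c) a = 0) \<and> laplace (u c) c \<noteq> 0"
    by (intro bchoice ballI)
  then obtain u where u: "\<forall>c\<in>C. (\<forall>a\<in>A \<union> (C - {c}). laplace (u c) a = 0) \<and> laplace (u c) c \<noteq> 0"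
    by (rule exE)
  have u0: "laplace (u c) a = 0" if "c \<in> C" "a \<in> A \<union> (C - {c})" for c a
    using u that by blast
  have u1: "laplace (u c) c \<noteq> 0" if "c \<in> C" for c
    using u that by blast
  have inj: "inj_on u C"
  proof (rule inj_onI)
    fix c d assume "c \<in> C" "d \<in> C" "u c = u d"
    then show "c = d"
      using u0[of c d] u1[of d] by auto
  qed
  have "l2.independent (u ` C)"
    unfolding l2.independent_explicit_finite_subsets
  proof (intro allI impI ballI)
    fix T k v
    assume T: "T \<subseteq> u ` C" "finite T" "(\<Sum>v\<in>T. l2_scale (k v) v) = 0" and "v \<in> T"
    then obtain c where c: "c \<in> C" "v = u c" by blast
    then have "c > 0" using C by auto
    have "0 = laplace (\<Sum>v\<in>T. l2_scale (k v) v) c"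
      by (simp add: T laplace_zero)
    also have "\<dots> = (\<Sum>v\<in>T. k v * laplace v c)"
      using \<open>c > 0\<close> by (rule laplace_sum)
    also have "\<dots> = (\<Sum>w\<in>T. if w = v then k v * laplace v c else 0)"
    proof (intro sum.cong refl)
      fix w assume "w \<in> T"
      then obtain d where d: "d \<in> C" "w = u d" using T by blast
      show "k w * laplace w c = (if w = v then k v * laplace v c else 0)"
        using u0[of d c] c d by (cases "d = c") auto
    qed
    also have "\<dots> = k v * laplace v c"
      using T \<open>v \<in> T\<close> by simp
    finally show "k v = 0"
      using u1 c by auto
  qed
  moreover have "u ` C \<subseteq> l2.span B"
  proof
    fix w assume "w \<in> u ` C"
    then obtain c where "c \<in> C" "w = u c" by blast
    then have "w \<in> V"
      using u0[of c] by (intro V) simp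
    then show "w \<in> l2.span B"
      using B(2) by (rule subsetD[rotated])
  qed
  ultimately have "card (u ` C) \<le> card B"
    using l2.independent_span_bound[OF B(1)] by blast
  then show False
    using C inj by (simp add: card_image)
qed

section \<open>Measures carried by a Blaschke sequence\<close>

text \<open>
  The complement of the support is covered by open null sets, countably many of which suffice by
  the Lindelof property.
\<close>

lemma emeasure_negative_half_line:
  assumes \<mu>: "sets \<mu> = sets borel" and supp: "measure_support \<mu> \<subseteq> {0..}"
  shows "emeasure \<mu> {..<0} = 0"
proof -
  define \<U> where "\<U> = {U :: real set. open U \<and> emeasure \<mu> U = 0}"
  have "open U" if "U \<in> \<U>" for U
    using that by (simp add: \<U>_def)
  then obtain \<V> where \<V>: "\<V> \<subseteq> \<U>" "countable \<V>" "\<Union>\<V> = \<Union>\<U>"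
    by (rule Lindelof)
  have sub: "{..<0} \<subseteq> \<Union>\<U>"
  proof
    fix x :: real assume "x \<in> {..<0}"
    then have "x \<notin> measure_support \<mu>"
      using subsetD[OF supp, of x] by force
    then obtain U where U: "open U" "x \<in> U" "\<not> emeasure \<mu> U > 0"
      unfolding measure_support_def by blast
    then have "U \<in> \<U>"
      unfolding \<U>_def not_gr_zero by simp
    with \<open>x \<in> U\<close> show "x \<in> \<Union>\<U>"
      by (rule UnionI[rotated])
  qed
  have "(\<Union>U\<in>\<V>. U) \<in> null_sets \<mu>"
  proof (rule null_sets_UN'[OF \<V>(2)])
    fix U assume "U \<in> \<V>"
    then have "open U" "emeasure \<mu> U = 0"
      using subsetD[OF \<V>(1)] unfolding \<U>_def by simp_all
    then show "U \<in> null_sets \<mu>"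
      by (intro null_setsI) (simp_all add: \<mu>)
  qed
  then have null: "\<Union>\<U> \<in> null_sets \<mu>"
    unfolding \<V>(3)[symmetric] by simp
  have "{..<0} \<in> null_sets \<mu>"
    by (rule null_sets_subset[OF null _ sub]) (simp add: \<mu>)
  then show ?thesis
    by (rule null_setsD1)
qed

lemma sets_borel_Diff_countable:
  fixes A :: "'a::t1_space set"
  assumes "countable A"
  shows "UNIV - A \<in> sets borel"
proof -
  have "A \<in> sets borel"
    by (rule sets.countable) (use assms in auto)
  then show ?thesis
    by auto
qed

lemma purely_atomic_if_countable:
  assumes \<mu>: "sets \<mu> = sets borel" and A: "countable A" "emeasure \<mu> (UNIV - A) = 0"
  shows "purely_atomic (\<mu> :: real measure)"
  unfolding purely_atomic_def
proof (intro ballI impI)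
  fix E assume E: "E \<in> sets \<mu>" "emeasure \<mu> E > 0"
  have singleton: "{x} \<in> sets \<mu>" for x
    by (simp add: \<mu>)
  have "\<exists>x\<in>E. emeasure \<mu> {x} > 0"
  proof (rule ccontr)
    assume "\<not> (\<exists>x\<in>E. emeasure \<mu> {x} > 0)"
    then have "(\<Union>x\<in>E \<inter> A. {x}) \<in> null_sets \<mu>"
      using A singleton by (intro null_sets_UN') auto
    moreover have "UNIV - A \<in> null_sets \<mu>"
      using A \<mu> sets_borel_Diff_countable[of A] by (intro null_setsI) auto
    ultimately have "(\<Union>x\<in>E \<inter> A. {x}) \<union> (UNIV - A) \<in> null_sets \<mu>"
      by (rule null_sets.Un)
    then have "E \<in> null_sets \<mu>"
      by (rule null_sets_subset) (use E in auto)
    then show False using E by (auto simp: null_sets_def)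
  qed
  then obtain x where x: "x \<in> E" "emeasure \<mu> {x} > 0" by blast
  have "measure_atom \<mu> {x}"
    unfolding measure_atom_def using x singleton by (auto simp: subset_singleton_iff)
  then show "\<exists>A\<subseteq>E. measure_atom \<mu> A"
    using x by (intro exI[of _ "{x}"]) auto
qed

text \<open>
  \<open>Z\<close> may be finite or empty, so it is first enlarged by the points \<open>2\<^sup>-\<^sup>k\<close>, which satisfy the Blaschke
  condition; the union is countably infinite and can be enumerated without repetition.
\<close>

lemma blaschke_enumeration:
  assumes Z: "Z \<subseteq> {0<..}" "(\<lambda>a. a / (a\<^sup>2 + 1)) summable_on Z"
  obtains a :: "nat \<Rightarrow> real" where "\<And>k. a k > 0" "Z \<subseteq> range a" "summable (\<lambda>k. a k / ((a k)\<^sup>2 + 1))"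
proof -
  let ?w = "\<lambda>a::real. a / (a\<^sup>2 + 1)"
  let ?D = "range (\<lambda>k::nat. (1 / 2) ^ k :: real)"
  have inj: "inj (\<lambda>k::nat. (1 / 2) ^ k :: real)"
    by (auto simp: inj_on_def power_one_over)
  have D: "?w summable_on ?D"
    unfolding summable_on_reindex[OF inj]
  proof (rule summable_on_comparison_test)
    show "(\<lambda>k::nat. (1 / 2) ^ k :: real) summable_on UNIV"
      by (simp add: summable_on_UNIV_nonneg_real_iff summable_geometric)
    show "(?w \<circ> (\<lambda>k. (1 / 2) ^ k)) k \<le> (1 / 2) ^ k" for k :: nat
      by (simp add: divide_le_eq add_pos_nonneg)
  qed auto
  have w: "?w summable_on (Z \<union> ?D)"
    using Z D by (intro summable_on_union)
  have pos: "a > 0" if "a \<in> Z \<union> ?D" for a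
    using that Z by auto
  have "countable (Z \<union> ?D)"
    by (rule countable_if_summable[OF _ w]) (use pos in auto)
  moreover have "infinite (Z \<union> ?D)"
    using range_inj_infinite[OF inj] by simp
  ultimately have bij: "bij_betw (from_nat_into (Z \<union> ?D)) UNIV (Z \<union> ?D)"
    by (rule bij_betw_from_nat_into)
  have "(\<lambda>k. ?w (from_nat_into (Z \<union> ?D) k)) summable_on UNIV"
    using w unfolding summable_on_reindex_bij_betw[OF bij, of ?w] .
  then have "summable (\<lambda>k. ?w (from_nat_into (Z \<union> ?D) k))"
    by (rule summable_on_imp_summable)
  moreover have range: "range (from_nat_into (Z \<union> ?D)) = Z \<union> ?D"
    using bij by (simp add: bij_betw_def)
  moreover have "from_nat_into (Z \<union> ?D) k > 0" for k
    by (rule pos) (use range in blast)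
  ultimately show ?thesis
    by (intro that[of "from_nat_into (Z \<union> ?D)"]) simp_all
qed

section \<open>Kernels of Hankel operators\<close>

theorem theorem2p5:
  fixes \<mu> :: "real measure"
  assumes "\<mu> \<in> laplace_measures"
  shows "(operator_kernel (hankel_operator \<mu>) = {0} \<or>
            infinite_dimensional (operator_kernel (hankel_operator \<mu>))) \<and>
         (infinite_dimensional (operator_kernel (hankel_operator \<mu>)) \<longleftrightarrow>
            purely_atomic \<mu> \<and>
            (\<exists>a :: nat \<Rightarrow> real. (\<forall>k. a k > 0) \<and> emeasure \<mu> (UNIV - range a) = 0 \<and>
               summable (\<lambda>k. a k / ((a k)\<^sup>2 + 1))))"
proof -
  let ?K = "operator_kernel (hankel_operator \<mu>)"
  let ?P = "\<lambda>a :: nat \<Rightarrow> real. (\<forall>k. a k > 0) \<and> emeasure \<mu> (UNIV - range a) = 0 \<and>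
               summable (\<lambda>k. a k / ((a k)\<^sup>2 + 1))"
  have sets: "sets \<mu> = sets borel" and supp: "measure_support \<mu> \<subseteq> {0..}" and zero: "emeasure \<mu> {0} = 0"
    using assms by (auto simp: laplace_measures_def)
  have K: "?K = laplace_kernel \<mu>"
    using sets by (rule operator_kernel_hankel_operator)
  have "0 \<in> ?K"
    by (simp add: K laplace_kernel_def laplace_zero)
  have atomic: "purely_atomic \<mu> \<and> (\<exists>a. ?P a)" if "?K \<noteq> {0}"
  proof -
    obtain u where u: "u \<in> laplace_kernel \<mu>" "u \<noteq> 0"
      using \<open>?K \<noteq> {0}\<close> \<open>0 \<in> ?K\<close> K by blast
    obtain b where b: "b > 0" "laplace u b \<noteq> 0"
      using laplace_inject[of u] u by blast
    define Z where "Z = {a. a > 0 \<and> laplace u a = 0}"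
    have "(\<lambda>a. a / (a\<^sup>2 + 1)) summable_on Z"
      using laplace_integral_zeros_summable[OF square_integrable_rep[of u] b(1)] b(2)
      by (simp add: Z_def laplace_rep)
    then obtain a where a: "\<And>k. a k > 0" "Z \<subseteq> range a" "summable (\<lambda>k. a k / ((a k)\<^sup>2 + 1))"
      using blaschke_enumeration[of Z] by (auto simp: Z_def)
    have "AE x in \<mu>. x \<in> range a"
    proof -
      have "{..<0} \<in> null_sets \<mu>" "{0} \<in> null_sets \<mu>"
        using emeasure_negative_half_line[OF sets supp] zero by (auto simp: sets intro!: null_setsI)
      from this[THEN AE_not_in] have "AE x in \<mu>. x \<notin> {..<0}" "AE x in \<mu>. x \<notin> {0}" .
      moreover have "AE x in \<mu>. x > 0 \<longrightarrow> laplace u x = 0"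
        using u by (simp add: laplace_kernel_def)
      ultimately show ?thesis
        by eventually_elim (use a(2) in \<open>auto simp: Z_def\<close>)
    qed
    then have "AE x in \<mu>. x \<notin> UNIV - range a"
      by simp
    moreover have "UNIV - range a \<in> sets \<mu>"
      unfolding sets by (rule sets_borel_Diff_countable) simp
    ultimately have null: "emeasure \<mu> (UNIV - range a) = 0"
      by (intro null_setsD1) (simp only: AE_iff_null_sets)
    then have "purely_atomic \<mu>"
      by (intro purely_atomic_if_countable[OF sets, of "range a"]) auto
    with null a show ?thesis
      by (intro conjI exI[of _ a] allI) simp_all
  qed
  have infinite: "infinite_dimensional ?K" if a: "?P a" for a
  proof (rule infinite_dimensional_if_zeros)
    show "range a \<subseteq> {0<..}"
      using a by auto
    \<comment> \<open>The sequence may repeat values; restricting to \<open>I\<close> selects one index for each of them.\<close>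
    obtain I where I: "inj_on a I" "range a = a ` I"
      using subset_image_inj[of "range a" a UNIV] by auto
    have "(\<lambda>k. a k / ((a k)\<^sup>2 + 1)) summable_on UNIV"
      using a by (subst summable_on_UNIV_nonneg_real_iff) (auto simp: less_imp_le)
    then have "(\<lambda>k. a k / ((a k)\<^sup>2 + 1)) summable_on I"
      by (rule summable_on_subset) simp
    then show "(\<lambda>x. x / (x\<^sup>2 + 1)) summable_on range a"
      unfolding I(2) summable_on_reindex[OF I(1)] by (simp add: o_def)
    fix u assume u: "\<And>x. x \<in> range a \<Longrightarrow> laplace u x = 0"
    have "UNIV - range a \<in> null_sets \<mu>"
      using a sets sets_borel_Diff_countable[of "range a"] by (intro null_setsI) auto
    then have "AE x in \<mu>. x \<notin> UNIV - range a"
      by (rule AE_not_in)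
    then have "AE x in \<mu>. x > 0 \<longrightarrow> laplace u x = 0"
      by (rule eventually_mono) (use u in blast)
    then show "u \<in> ?K"
      unfolding K laplace_kernel_def by simp
  qed
  have nontrivial: "?K \<noteq> {0}" if "infinite_dimensional ?K"
  proof
    assume "?K = {0}"
    then have "finite {} \<and> ?K \<subseteq> l2.span {}"
      by simp
    then have "\<exists>B. finite B \<and> ?K \<subseteq> l2.span B"
      by (rule exI)
    with that show False
      unfolding infinite_dimensional_def by (rule notE)
  qed
  have iff: "infinite_dimensional ?K \<longleftrightarrow> purely_atomic \<mu> \<and> (\<exists>a. ?P a)"
  proof
    assume "infinite_dimensional ?K"
    then show "purely_atomic \<mu> \<and> (\<exists>a. ?P a)"
      by (intro atomic nontrivial)
  next
    assume "purely_atomic \<mu> \<and> (\<exists>a. ?P a)"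
    then show "infinite_dimensional ?K"
      by (elim conjE exE) (intro infinite conjI)
  qed
  moreover have "?K = {0} \<or> infinite_dimensional ?K"
    using atomic iff by argo
  ultimately show ?thesis
    by (intro conjI)
qed

end
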